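(* Let $\mathcal A$ be a triangulated monoidal category and let $(\mathbf U_i,\eta_i)$ be unital idempotents in $\mathcal A$ ($i=1,2$), fitting into distinguished triangles $\mathbf C_i\xrightarrow{\varepsilon_i}\mathbb 1\xrightarrow{\eta_i}\mathbf U_i\xrightarrow{\delta_i}\mathbf C_i[1]$ with complementary idempotents $\mathbf C_i$. The following are equivalent: (1) $\mathbf U_1\otimes\mathbf U_2\cong\mathbf U_2$; (2) $\mathbf U_2\otimes\mathbf U_1\cong\mathbf U_2$; (3) there exists a map $\nu:\mathbf U_1\to\mathbf U_2$ such that $\nu\circ\eta_1=\eta_2$. Furthermore, if any of these equivalent statements is true, then the map $\nu$ is unique, and there is a unique morphism of triangles from $\mathbf C_1\xrightarrow{\varepsilon_1}\mathbb 1\xrightarrow{\eta_1}\mathbf U_1\xrightarrow{\delta_1}\mathbf C_1[1]$ to $\mathbf C_2\xrightarrow{\varepsilon_2}\mathbb 1\xrightarrow{\eta_2}\mathbf U_2\xrightarrow{\delta_2}\mathbf C_2[1]$ whose component $\mathbb 1\to\mathbb 1$ is $\mathrm{Id}$ and whose component $\mathbf U_1\to\mathbf U_2$ is $\nu$. Similarly for counital idempotents: if $(\mathbf C_i,\varepsilon_i)$ are counital idempotents ($i=1,2$), then the following are equivalent: $\mathbf C_1\otimes\mathbf C_2\cong\mathbf C_1$; $\mathbf C_2\otimes\mathbf C_1\cong\mathbf C_1$; there exists $\theta:\mathbf C_1\to\mathbf C_2$ with $\varepsilon_2\circ\theta=\varepsilon_1$. If these hold, $\theta$ is unique and there is a unique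 morphism of the corresponding triangles with component $\mathrm{Id}$ on $\mathbb 1$ and component $\theta$ from $\mathbf C_1$ to $\mathbf C_2$.
   Context: A triangulated monoidal category is an additive category $\mathcal A$ equipped with: a triangulated structure (an invertible suspension endofunctor $[1]$ and a class of distinguished triangles satisfying the usual axioms, including Verdier's octahedral axiom); a monoidal structure $(\otimes,\mathbb 1)$ with left unitor $\lambda$; and natural isomorphisms $\alpha_A:A\otimes\mathbb 1[1]\to A[1]$ and $\beta_A:\mathbb 1[1]\otimes A\to A\otimes\mathbb 1[1]$ such that (suppressing associators) $\alpha_{\mathbb 1}=\lambda_{\mathbb 1[1]}$, $\alpha_{A[1]}\circ(\alpha_A\otimes\mathrm{Id}_{\mathbb 1[1]})=\alpha_A[1]\circ\alpha_{A\otimes\mathbb 1[1]}$, $\beta_{\mathbb 1[1]}=-\mathrm{Id}$, and $\beta_{A\otimes B}=(\mathrm{Id}_A\otimes\beta_B)\circ(\beta_A\otimes\mathrm{Id}_B)$. Further, for each distinguished triangle $A\to B\to C\to A[1]$ and each object $D$, the triangles $D\otimes A\to D\otimes B\to D\otimes C\to (D\otimes A)[1]$ and $A\otimes D\to B\otimes D\to C\otimes D\to (A\otimes D)[1]$ are distinguished, where the identifications $D\otimes A[1]\cong(D\otimes A)[1]$ and $A[1]\otimes D\cong(A\otimes D)[1]$ are built from $\alpha,\beta$ and the associator. A pair of complementary idempotents in $\mathcal A$ is a pair of objects $(\mathbf C,\mathbf U)$ with $\mathbf C\otimes\mathbf U\cong 0\cong\mathbf U\otimes\mathbf C$, together with a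 distinguished triangle $\mathbf C\xrightarrow{\varepsilon}\mathbb 1\xrightarrow{\eta}\mathbf U\xrightarrow{\delta}\mathbf C[1]$. In this case $(\mathbf U,\eta)$ is called a unital idempotent, $(\mathbf C,\varepsilon)$ a counital idempotent, and each is called the complementary idempotent of the other. Every unital idempotent and every counital idempotent fits into such a triangle. *)

theory Defs
  imports "HOL-Algebra.Group"
begin

section \<open>Categories\<close>

text \<open>
  Objects are the elements of \<open>Ob\<close>, and \<open>Hom A B\<close> is the set of morphisms \<open>A \<rightarrow> B\<close>.  Every
  statement about a morphism names its source and target, so hom-sets need not be disjoint.
\<close>

record ('o, 'm) category =
  Ob :: "'o set"
  Hom :: "'o \<Rightarrow> 'o \<Rightarrow> 'm set"
  ident :: "'o \<Rightarrow> 'm"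
  comp :: "'m \<Rightarrow> 'm \<Rightarrow> 'm"  (infixr "\<cdot>\<index>" 65)

locale category =
  fixes \<A> :: "('o, 'm, 'x) category_scheme" (structure)
  assumes ident_in: "A \<in> Ob \<A> \<Longrightarrow> ident \<A> A \<in> Hom \<A> A A"
    and comp_in: "\<lbrakk>A \<in> Ob \<A>; B \<in> Ob \<A>; C \<in> Ob \<A>; f \<in> Hom \<A> A B; g \<in> Hom \<A> B C\<rbrakk>
      \<Longrightarrow> g \<cdot> f \<in> Hom \<A> A C"
    and comp_ident: "\<lbrakk>A \<in> Ob \<A>; B \<in> Ob \<A>; f \<in> Hom \<A> A B\<rbrakk> \<Longrightarrow> f \<cdot> ident \<A> A = f"
    and ident_comp: "\<lbrakk>A \<in> Ob \<A>; B \<in> Ob \<A>; f \<in> Hom \<A> A B\<rbrakk> \<Longrightarrow> ident \<A> B \<cdot> f = f"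
    and comp_assoc: "\<lbrakk>A \<in> Ob \<A>; B \<in> Ob \<A>; C \<in> Ob \<A>; D \<in> Ob \<A>;
        f \<in> Hom \<A> A B; g \<in> Hom \<A> B C; h \<in> Hom \<A> C D\<rbrakk>
      \<Longrightarrow> (h \<cdot> g) \<cdot> f = h \<cdot> (g \<cdot> f)"

definition inverse_mors ::
    "('o, 'm, 'x) category_scheme \<Rightarrow> 'o \<Rightarrow> 'o \<Rightarrow> 'm \<Rightarrow> 'm \<Rightarrow> bool" where
  "inverse_mors \<A> A B f g \<longleftrightarrow> f \<in> Hom \<A> A B \<and> g \<in> Hom \<A> B A
     \<and> g \<cdot>\<^bsub>\<A>\<^esub> f = ident \<A> A \<and> f \<cdot>\<^bsub>\<A>\<^esub> g = ident \<A> B"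

definition iso_mor :: "('o, 'm, 'x) category_scheme \<Rightarrow> 'o \<Rightarrow> 'o \<Rightarrow> 'm \<Rightarrow> bool" where
  "iso_mor \<A> A B f \<longleftrightarrow> (\<exists>g. inverse_mors \<A> A B f g)"

definition inv_mor :: "('o, 'm, 'x) category_scheme \<Rightarrow> 'o \<Rightarrow> 'o \<Rightarrow> 'm \<Rightarrow> 'm" where
  "inv_mor \<A> A B f = (THE g. inverse_mors \<A> A B f g)"

definition iso_obj :: "('o, 'm, 'x) category_scheme \<Rightarrow> 'o \<Rightarrow> 'o \<Rightarrow> bool" (infix "\<simeq>\<index>" 50) where
  "A \<simeq>\<^bsub>\<A>\<^esub> B \<longleftrightarrow> (\<exists>f. iso_mor \<A> A B f)"

definition zero_object :: "('o, 'm, 'x) category_scheme \<Rightarrow> 'o \<Rightarrow> bool" where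
  "zero_object \<A> Z \<longleftrightarrow> Z \<in> Ob \<A> \<and>
     (\<forall>A\<in>Ob \<A>. (\<exists>!f. f \<in> Hom \<A> A Z) \<and> (\<exists>!f. f \<in> Hom \<A> Z A))"

definition iso_zero :: "('o, 'm, 'x) category_scheme \<Rightarrow> 'o \<Rightarrow> bool" where
  "iso_zero \<A> A \<longleftrightarrow> (\<exists>Z. zero_object \<A> Z \<and> A \<simeq>\<^bsub>\<A>\<^esub> Z)"


section \<open>Additive categories\<close>

record ('o, 'm) preadditive_category = "('o, 'm) category" +
  add_mor :: "'m \<Rightarrow> 'm \<Rightarrow> 'm"  (infixl "\<oplus>\<^sub>m\<index>" 62)
  zero_mor :: "'o \<Rightarrow> 'o \<Rightarrow> 'm"

text \<open>The additive group of morphisms \<open>A \<rightarrow> B\<close>, as a (multiplicatively written) group record.\<close>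

definition hom_group ::
    "('o, 'm, 'x) preadditive_category_scheme \<Rightarrow> 'o \<Rightarrow> 'o \<Rightarrow> 'm monoid" where
  "hom_group \<A> A B = \<lparr>carrier = Hom \<A> A B, monoid.mult = add_mor \<A>, one = zero_mor \<A> A B\<rparr>"

definition neg_mor :: "('o, 'm, 'x) preadditive_category_scheme \<Rightarrow> 'o \<Rightarrow> 'o \<Rightarrow> 'm \<Rightarrow> 'm" where
  "neg_mor \<A> A B f = inv\<^bsub>hom_group \<A> A B\<^esub> f"

locale additive_category = category \<A>
  for \<A> :: "('o, 'm, 'x) preadditive_category_scheme" (structure) +
  assumes hom_comm_group: "\<lbrakk>A \<in> Ob \<A>; B \<in> Ob \<A>\<rbrakk> \<Longrightarrow> comm_group (hom_group \<A> A B)"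
    and comp_add_right: "\<lbrakk>A \<in> Ob \<A>; B \<in> Ob \<A>; C \<in> Ob \<A>;
        f \<in> Hom \<A> A B; f' \<in> Hom \<A> A B; g \<in> Hom \<A> B C\<rbrakk>
      \<Longrightarrow> g \<cdot> (f \<oplus>\<^sub>m f') = (g \<cdot> f) \<oplus>\<^sub>m (g \<cdot> f')"
    and comp_add_left: "\<lbrakk>A \<in> Ob \<A>; B \<in> Ob \<A>; C \<in> Ob \<A>;
        f \<in> Hom \<A> A B; g \<in> Hom \<A> B C; g' \<in> Hom \<A> B C\<rbrakk>
      \<Longrightarrow> (g \<oplus>\<^sub>m g') \<cdot> f = (g \<cdot> f) \<oplus>\<^sub>m (g' \<cdot> f)"
    and ex_zero_object: "\<exists>Z. zero_object \<A> Z"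
    and ex_biproduct: "\<lbrakk>A \<in> Ob \<A>; B \<in> Ob \<A>\<rbrakk> \<Longrightarrow>
      \<exists>P \<in> Ob \<A>. \<exists>i\<^sub>1 \<in> Hom \<A> A P. \<exists>i\<^sub>2 \<in> Hom \<A> B P. \<exists>p\<^sub>1 \<in> Hom \<A> P A. \<exists>p\<^sub>2 \<in> Hom \<A> P B.
        p\<^sub>1 \<cdot> i\<^sub>1 = ident \<A> A \<and> p\<^sub>2 \<cdot> i\<^sub>2 = ident \<A> B \<and>
        p\<^sub>2 \<cdot> i\<^sub>1 = zero_mor \<A> A B \<and> p\<^sub>1 \<cdot> i\<^sub>2 = zero_mor \<A> B A \<and>
        (i\<^sub>1 \<cdot> p\<^sub>1) \<oplus>\<^sub>m (i\<^sub>2 \<cdot> p\<^sub>2) = ident \<A> P"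


section \<open>Triangulated categories\<close>

text \<open>The tuple \<open>(A, B, C, f, g, h)\<close> stands for the triangle \<open>A \<rightarrow> B \<rightarrow> C \<rightarrow> A[1]\<close> with maps \<open>f, g, h\<close>.\<close>

type_synonym ('o, 'm) triangle = "'o \<times> 'o \<times> 'o \<times> 'm \<times> 'm \<times> 'm"

record ('o, 'm) pretriangulated_category = "('o, 'm) preadditive_category" +
  shift_obj :: "'o \<Rightarrow> 'o"  ("_\<lbrakk>1\<rbrakk>\<^sub>o\<index>" [1000] 1000)
  shift_mor :: "'m \<Rightarrow> 'm"  ("_\<lbrakk>1\<rbrakk>\<^sub>m\<index>" [1000] 1000)
  Dist :: "('o, 'm) triangle set"

fun is_triangle ::
    "('o, 'm, 'x) pretriangulated_category_scheme \<Rightarrow> ('o, 'm) triangle \<Rightarrow> bool" where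
  "is_triangle \<A> (A, B, C, f, g, h) \<longleftrightarrow> A \<in> Ob \<A> \<and> B \<in> Ob \<A> \<and> C \<in> Ob \<A> \<and>
     f \<in> Hom \<A> A B \<and> g \<in> Hom \<A> B C \<and> h \<in> Hom \<A> C (A\<lbrakk>1\<rbrakk>\<^sub>o\<^bsub>\<A>\<^esub>)"

fun triangle_mor ::
    "('o, 'm, 'x) pretriangulated_category_scheme \<Rightarrow> ('o, 'm) triangle \<Rightarrow> ('o, 'm) triangle
      \<Rightarrow> 'm \<Rightarrow> 'm \<Rightarrow> 'm \<Rightarrow> bool" where
  "triangle_mor \<A> (A, B, C, f, g, h) (A', B', C', f', g', h') a b c \<longleftrightarrow>
     a \<in> Hom \<A> A A' \<and> b \<in> Hom \<A> B B' \<and> c \<in> Hom \<A> C C' \<and>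
     b \<cdot>\<^bsub>\<A>\<^esub> f = f' \<cdot>\<^bsub>\<A>\<^esub> a \<and> c \<cdot>\<^bsub>\<A>\<^esub> g = g' \<cdot>\<^bsub>\<A>\<^esub> b \<and>
     a\<lbrakk>1\<rbrakk>\<^sub>m\<^bsub>\<A>\<^esub> \<cdot>\<^bsub>\<A>\<^esub> h = h' \<cdot>\<^bsub>\<A>\<^esub> c"

text \<open>
  The suspension is an automorphism of the category: bijective on objects and on hom-sets.
\<close>

locale triangulated_category = additive_category \<A>
  for \<A> :: "('o, 'm, 'x) pretriangulated_category_scheme" (structure) +
  assumes shift_obj_bij: "bij_betw (shift_obj \<A>) (Ob \<A>) (Ob \<A>)"
    and shift_mor_bij: "\<lbrakk>A \<in> Ob \<A>; B \<in> Ob \<A>\<rbrakk> \<Longrightarrow>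
      bij_betw (shift_mor \<A>) (Hom \<A> A B) (Hom \<A> (A\<lbrakk>1\<rbrakk>\<^sub>o) (B\<lbrakk>1\<rbrakk>\<^sub>o))"
    and shift_ident: "A \<in> Ob \<A> \<Longrightarrow> (ident \<A> A)\<lbrakk>1\<rbrakk>\<^sub>m = ident \<A> (A\<lbrakk>1\<rbrakk>\<^sub>o)"
    and shift_comp: "\<lbrakk>A \<in> Ob \<A>; B \<in> Ob \<A>; C \<in> Ob \<A>; f \<in> Hom \<A> A B; g \<in> Hom \<A> B C\<rbrakk>
      \<Longrightarrow> (g \<cdot> f)\<lbrakk>1\<rbrakk>\<^sub>m = g\<lbrakk>1\<rbrakk>\<^sub>m \<cdot> f\<lbrakk>1\<rbrakk>\<^sub>m"
    and shift_add: "\<lbrakk>A \<in> Ob \<A>; B \<in> Ob \<A>; f \<in> Hom \<A> A B; f' \<in> Hom \<A> A B\<rbrakk>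
      \<Longrightarrow> (f \<oplus>\<^sub>m f')\<lbrakk>1\<rbrakk>\<^sub>m = f\<lbrakk>1\<rbrakk>\<^sub>m \<oplus>\<^sub>m f'\<lbrakk>1\<rbrakk>\<^sub>m"
    and Dist_triangle: "T \<in> Dist \<A> \<Longrightarrow> is_triangle \<A> T"
    and Dist_iso: "\<lbrakk>(A, B, C, f, g, h) \<in> Dist \<A>; is_triangle \<A> (A', B', C', f', g', h');
        triangle_mor \<A> (A, B, C, f, g, h) (A', B', C', f', g', h') a b c;
        iso_mor \<A> A A' a; iso_mor \<A> B B' b; iso_mor \<A> C C' c\<rbrakk>
      \<Longrightarrow> (A', B', C', f', g', h') \<in> Dist \<A>"
    and Dist_ident: "\<lbrakk>A \<in> Ob \<A>; zero_object \<A> Z\<rbrakk>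
      \<Longrightarrow> (A, A, Z, ident \<A> A, zero_mor \<A> A Z, zero_mor \<A> Z (A\<lbrakk>1\<rbrakk>\<^sub>o)) \<in> Dist \<A>"
    and Dist_ex: "\<lbrakk>A \<in> Ob \<A>; B \<in> Ob \<A>; f \<in> Hom \<A> A B\<rbrakk>
      \<Longrightarrow> \<exists>C g h. (A, B, C, f, g, h) \<in> Dist \<A>"
    and Dist_rotate: "is_triangle \<A> (A, B, C, f, g, h) \<Longrightarrow>
      (A, B, C, f, g, h) \<in> Dist \<A> \<longleftrightarrow>
      (B, C, A\<lbrakk>1\<rbrakk>\<^sub>o, g, h, neg_mor \<A> (A\<lbrakk>1\<rbrakk>\<^sub>o) (B\<lbrakk>1\<rbrakk>\<^sub>o) (f\<lbrakk>1\<rbrakk>\<^sub>m)) \<in> Dist \<A>"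
    and Dist_complete: "\<lbrakk>(A, B, C, f, g, h) \<in> Dist \<A>; (A', B', C', f', g', h') \<in> Dist \<A>;
        a \<in> Hom \<A> A A'; b \<in> Hom \<A> B B'; b \<cdot> f = f' \<cdot> a\<rbrakk>
      \<Longrightarrow> \<exists>c. triangle_mor \<A> (A, B, C, f, g, h) (A', B', C', f', g', h') a b c"
    and Dist_octahedral: "\<lbrakk>(X, Y, Z', u, i, i') \<in> Dist \<A>; (Y, Z, X', v, j, j') \<in> Dist \<A>;
        (X, Z, Y', v \<cdot> u, k, k') \<in> Dist \<A>\<rbrakk>
      \<Longrightarrow> \<exists>f g. (Z', Y', X', f, g, i\<lbrakk>1\<rbrakk>\<^sub>m \<cdot> j') \<in> Dist \<A> \<and>
            f \<cdot> i = k \<cdot> v \<and> k' \<cdot> f = i' \<and> g \<cdot> k = j \<and> j' \<cdot> g = u\<lbrakk>1\<rbrakk>\<^sub>m \<cdot> k'"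


section \<open>Monoidal categories\<close>

text \<open>
  For later use the record also carries the isomorphisms
  \<open>alph A : A \<otimes> \<one>[1] \<rightarrow> A[1]\<close> and \<open>bet A : \<one>[1] \<otimes> A \<rightarrow> A \<otimes> \<one>[1]\<close>; the monoidal axioms mention
  neither these nor the triangulated structure.  Directions of the structure maps:
  \<open>assoc A B C : (A \<otimes> B) \<otimes> C \<rightarrow> A \<otimes> (B \<otimes> C)\<close>, \<open>lun A : \<one> \<otimes> A \<rightarrow> A\<close>, \<open>run A : A \<otimes> \<one> \<rightarrow> A\<close>.
\<close>

record ('o, 'm) tensor_triangulated = "('o, 'm) pretriangulated_category" +
  tens_obj :: "'o \<Rightarrow> 'o \<Rightarrow> 'o"  (infixl "\<otimes>\<^sub>o\<index>" 70)
  tens_mor :: "'m \<Rightarrow> 'm \<Rightarrow> 'm"  (infixl "\<otimes>\<^sub>m\<index>" 70)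
  unit_obj :: "'o"  ("\<one>\<^sub>o\<index>")
  assoc :: "'o \<Rightarrow> 'o \<Rightarrow> 'o \<Rightarrow> 'm"
  lun :: "'o \<Rightarrow> 'm"
  run :: "'o \<Rightarrow> 'm"
  alph :: "'o \<Rightarrow> 'm"
  bet :: "'o \<Rightarrow> 'm"

locale monoidal_category = category \<A>
  for \<A> :: "('o, 'm, 'x) tensor_triangulated_scheme" (structure) +
  assumes unit_in: "\<one>\<^sub>o \<in> Ob \<A>"
    and tens_obj_in: "\<lbrakk>A \<in> Ob \<A>; B \<in> Ob \<A>\<rbrakk> \<Longrightarrow> A \<otimes>\<^sub>o B \<in> Ob \<A>"
    and tens_mor_in: "\<lbrakk>A \<in> Ob \<A>; A' \<in> Ob \<A>; B \<in> Ob \<A>; B' \<in> Ob \<A>;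
        f \<in> Hom \<A> A A'; g \<in> Hom \<A> B B'\<rbrakk> \<Longrightarrow> f \<otimes>\<^sub>m g \<in> Hom \<A> (A \<otimes>\<^sub>o B) (A' \<otimes>\<^sub>o B')"
    and tens_ident: "\<lbrakk>A \<in> Ob \<A>; B \<in> Ob \<A>\<rbrakk> \<Longrightarrow> ident \<A> A \<otimes>\<^sub>m ident \<A> B = ident \<A> (A \<otimes>\<^sub>o B)"
    and tens_comp: "\<lbrakk>A \<in> Ob \<A>; A' \<in> Ob \<A>; A'' \<in> Ob \<A>; B \<in> Ob \<A>; B' \<in> Ob \<A>; B'' \<in> Ob \<A>;
        f \<in> Hom \<A> A A'; f' \<in> Hom \<A> A' A''; g \<in> Hom \<A> B B'; g' \<in> Hom \<A> B' B''\<rbrakk>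
      \<Longrightarrow> (f' \<cdot> f) \<otimes>\<^sub>m (g' \<cdot> g) = (f' \<otimes>\<^sub>m g') \<cdot> (f \<otimes>\<^sub>m g)"
    and assoc_iso: "\<lbrakk>A \<in> Ob \<A>; B \<in> Ob \<A>; C \<in> Ob \<A>\<rbrakk>
      \<Longrightarrow> iso_mor \<A> ((A \<otimes>\<^sub>o B) \<otimes>\<^sub>o C) (A \<otimes>\<^sub>o (B \<otimes>\<^sub>o C)) (assoc \<A> A B C)"
    and assoc_natural: "\<lbrakk>A \<in> Ob \<A>; A' \<in> Ob \<A>; B \<in> Ob \<A>; B' \<in> Ob \<A>; C \<in> Ob \<A>; C' \<in> Ob \<A>;
        f \<in> Hom \<A> A A'; g \<in> Hom \<A> B B'; h \<in> Hom \<A> C C'\<rbrakk>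
      \<Longrightarrow> assoc \<A> A' B' C' \<cdot> ((f \<otimes>\<^sub>m g) \<otimes>\<^sub>m h) = (f \<otimes>\<^sub>m (g \<otimes>\<^sub>m h)) \<cdot> assoc \<A> A B C"
    and lun_iso: "A \<in> Ob \<A> \<Longrightarrow> iso_mor \<A> (\<one>\<^sub>o \<otimes>\<^sub>o A) A (lun \<A> A)"
    and lun_natural: "\<lbrakk>A \<in> Ob \<A>; B \<in> Ob \<A>; f \<in> Hom \<A> A B\<rbrakk>
      \<Longrightarrow> lun \<A> B \<cdot> (ident \<A> \<one>\<^sub>o \<otimes>\<^sub>m f) = f \<cdot> lun \<A> A"
    and run_iso: "A \<in> Ob \<A> \<Longrightarrow> iso_mor \<A> (A \<otimes>\<^sub>o \<one>\<^sub>o) A (run \<A> A)"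
    and run_natural: "\<lbrakk>A \<in> Ob \<A>; B \<in> Ob \<A>; f \<in> Hom \<A> A B\<rbrakk>
      \<Longrightarrow> run \<A> B \<cdot> (f \<otimes>\<^sub>m ident \<A> \<one>\<^sub>o) = f \<cdot> run \<A> A"
    and pentagon: "\<lbrakk>A \<in> Ob \<A>; B \<in> Ob \<A>; C \<in> Ob \<A>; D \<in> Ob \<A>\<rbrakk>
      \<Longrightarrow> assoc \<A> A B (C \<otimes>\<^sub>o D) \<cdot> assoc \<A> (A \<otimes>\<^sub>o B) C D =
          (ident \<A> A \<otimes>\<^sub>m assoc \<A> B C D) \<cdot> assoc \<A> A (B \<otimes>\<^sub>o C) D
            \<cdot> (assoc \<A> A B C \<otimes>\<^sub>m ident \<A> D)"
    and unit_triangle: "\<lbrakk>A \<in> Ob \<A>; B \<in> Ob \<A>\<rbrakk>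
      \<Longrightarrow> (ident \<A> A \<otimes>\<^sub>m lun \<A> B) \<cdot> assoc \<A> A \<one>\<^sub>o B = run \<A> A \<otimes>\<^sub>m ident \<A> B"


section \<open>Triangulated monoidal categories\<close>

text \<open>
  The identification \<open>D \<otimes> A[1] \<cong> (D \<otimes> A)[1]\<close>, as the composite
  \<open>D \<otimes> A[1] \<rightarrow> D \<otimes> (A \<otimes> \<one>[1]) \<rightarrow> (D \<otimes> A) \<otimes> \<one>[1] \<rightarrow> (D \<otimes> A)[1]\<close>.
\<close>

definition shift_out_right ::
    "('o, 'm, 'x) tensor_triangulated_scheme \<Rightarrow> 'o \<Rightarrow> 'o \<Rightarrow> 'm" where
  "shift_out_right \<A> D A =
     (let S = \<one>\<^sub>o\<^bsub>\<A>\<^esub>\<lbrakk>1\<rbrakk>\<^sub>o\<^bsub>\<A>\<^esub> in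
       alph \<A> (D \<otimes>\<^sub>o\<^bsub>\<A>\<^esub> A)
       \<cdot>\<^bsub>\<A>\<^esub> inv_mor \<A> ((D \<otimes>\<^sub>o\<^bsub>\<A>\<^esub> A) \<otimes>\<^sub>o\<^bsub>\<A>\<^esub> S) (D \<otimes>\<^sub>o\<^bsub>\<A>\<^esub> (A \<otimes>\<^sub>o\<^bsub>\<A>\<^esub> S)) (assoc \<A> D A S)
       \<cdot>\<^bsub>\<A>\<^esub> (ident \<A> D \<otimes>\<^sub>m\<^bsub>\<A>\<^esub> inv_mor \<A> (A \<otimes>\<^sub>o\<^bsub>\<A>\<^esub> S) (A\<lbrakk>1\<rbrakk>\<^sub>o\<^bsub>\<A>\<^esub>) (alph \<A> A)))"

text \<open>
  The identification \<open>A[1] \<otimes> D \<cong> (A \<otimes> D)[1]\<close>, as the composite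
  \<open>A[1] \<otimes> D \<rightarrow> (A \<otimes> \<one>[1]) \<otimes> D \<rightarrow> A \<otimes> (\<one>[1] \<otimes> D) \<rightarrow> A \<otimes> (D \<otimes> \<one>[1]) \<rightarrow> (A \<otimes> D) \<otimes> \<one>[1] \<rightarrow> (A \<otimes> D)[1]\<close>.
\<close>

definition shift_out_left ::
    "('o, 'm, 'x) tensor_triangulated_scheme \<Rightarrow> 'o \<Rightarrow> 'o \<Rightarrow> 'm" where
  "shift_out_left \<A> A D =
     (let S = \<one>\<^sub>o\<^bsub>\<A>\<^esub>\<lbrakk>1\<rbrakk>\<^sub>o\<^bsub>\<A>\<^esub> in
       alph \<A> (A \<otimes>\<^sub>o\<^bsub>\<A>\<^esub> D)
       \<cdot>\<^bsub>\<A>\<^esub> inv_mor \<A> ((A \<otimes>\<^sub>o\<^bsub>\<A>\<^esub> D) \<otimes>\<^sub>o\<^bsub>\<A>\<^esub> S) (A \<otimes>\<^sub>o\<^bsub>\<A>\<^esub> (D \<otimes>\<^sub>o\<^bsub>\<A>\<^esub> S)) (assoc \<A> A D S)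
       \<cdot>\<^bsub>\<A>\<^esub> (ident \<A> A \<otimes>\<^sub>m\<^bsub>\<A>\<^esub> bet \<A> D)
       \<cdot>\<^bsub>\<A>\<^esub> assoc \<A> A S D
       \<cdot>\<^bsub>\<A>\<^esub> (inv_mor \<A> (A \<otimes>\<^sub>o\<^bsub>\<A>\<^esub> S) (A\<lbrakk>1\<rbrakk>\<^sub>o\<^bsub>\<A>\<^esub>) (alph \<A> A) \<otimes>\<^sub>m\<^bsub>\<A>\<^esub> ident \<A> D))"

text \<open>
  In \<open>alph_shift\<close> no associator is needed; in \<open>bet_tens\<close> the associators are written out, with
  the final inverse one moved to the left-hand side.  Additivity of the tensor product is not
  an axiom: it follows from the exactness axioms \<open>Dist_tens_left\<close> and \<open>Dist_tens_right\<close>.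
\<close>

locale triangulated_monoidal_category =
  triangulated_category \<A> + monoidal_category \<A>
  for \<A> :: "('o, 'm, 'x) tensor_triangulated_scheme" (structure) +
  assumes alph_iso: "A \<in> Ob \<A> \<Longrightarrow> iso_mor \<A> (A \<otimes>\<^sub>o \<one>\<^sub>o\<lbrakk>1\<rbrakk>\<^sub>o) (A\<lbrakk>1\<rbrakk>\<^sub>o) (alph \<A> A)"
    and alph_natural: "\<lbrakk>A \<in> Ob \<A>; B \<in> Ob \<A>; f \<in> Hom \<A> A B\<rbrakk>
      \<Longrightarrow> alph \<A> B \<cdot> (f \<otimes>\<^sub>m ident \<A> (\<one>\<^sub>o\<lbrakk>1\<rbrakk>\<^sub>o)) = f\<lbrakk>1\<rbrakk>\<^sub>m \<cdot> alph \<A> A"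
    and bet_iso: "A \<in> Ob \<A> \<Longrightarrow> iso_mor \<A> (\<one>\<^sub>o\<lbrakk>1\<rbrakk>\<^sub>o \<otimes>\<^sub>o A) (A \<otimes>\<^sub>o \<one>\<^sub>o\<lbrakk>1\<rbrakk>\<^sub>o) (bet \<A> A)"
    and bet_natural: "\<lbrakk>A \<in> Ob \<A>; B \<in> Ob \<A>; f \<in> Hom \<A> A B\<rbrakk>
      \<Longrightarrow> bet \<A> B \<cdot> (ident \<A> (\<one>\<^sub>o\<lbrakk>1\<rbrakk>\<^sub>o) \<otimes>\<^sub>m f) = (f \<otimes>\<^sub>m ident \<A> (\<one>\<^sub>o\<lbrakk>1\<rbrakk>\<^sub>o)) \<cdot> bet \<A> A"
    and alph_unit: "alph \<A> \<one>\<^sub>o = lun \<A> (\<one>\<^sub>o\<lbrakk>1\<rbrakk>\<^sub>o)"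
    and alph_shift: "A \<in> Ob \<A> \<Longrightarrow>
      alph \<A> (A\<lbrakk>1\<rbrakk>\<^sub>o) \<cdot> (alph \<A> A \<otimes>\<^sub>m ident \<A> (\<one>\<^sub>o\<lbrakk>1\<rbrakk>\<^sub>o)) =
      (alph \<A> A)\<lbrakk>1\<rbrakk>\<^sub>m \<cdot> alph \<A> (A \<otimes>\<^sub>o \<one>\<^sub>o\<lbrakk>1\<rbrakk>\<^sub>o)"
    and bet_unit_shift: "bet \<A> (\<one>\<^sub>o\<lbrakk>1\<rbrakk>\<^sub>o) =
      neg_mor \<A> (\<one>\<^sub>o\<lbrakk>1\<rbrakk>\<^sub>o \<otimes>\<^sub>o \<one>\<^sub>o\<lbrakk>1\<rbrakk>\<^sub>o) (\<one>\<^sub>o\<lbrakk>1\<rbrakk>\<^sub>o \<otimes>\<^sub>o \<one>\<^sub>o\<lbrakk>1\<rbrakk>\<^sub>o)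
        (ident \<A> (\<one>\<^sub>o\<lbrakk>1\<rbrakk>\<^sub>o \<otimes>\<^sub>o \<one>\<^sub>o\<lbrakk>1\<rbrakk>\<^sub>o))"
    and bet_tens: "\<lbrakk>A \<in> Ob \<A>; B \<in> Ob \<A>\<rbrakk> \<Longrightarrow>
      assoc \<A> A B (\<one>\<^sub>o\<lbrakk>1\<rbrakk>\<^sub>o) \<cdot> bet \<A> (A \<otimes>\<^sub>o B) \<cdot> assoc \<A> (\<one>\<^sub>o\<lbrakk>1\<rbrakk>\<^sub>o) A B =
      (ident \<A> A \<otimes>\<^sub>m bet \<A> B) \<cdot> assoc \<A> A (\<one>\<^sub>o\<lbrakk>1\<rbrakk>\<^sub>o) B \<cdot> (bet \<A> A \<otimes>\<^sub>m ident \<A> B)"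
    and Dist_tens_left: "\<lbrakk>D \<in> Ob \<A>; (A, B, C, f, g, h) \<in> Dist \<A>\<rbrakk> \<Longrightarrow>
      (D \<otimes>\<^sub>o A, D \<otimes>\<^sub>o B, D \<otimes>\<^sub>o C, ident \<A> D \<otimes>\<^sub>m f, ident \<A> D \<otimes>\<^sub>m g,
        shift_out_right \<A> D A \<cdot> (ident \<A> D \<otimes>\<^sub>m h)) \<in> Dist \<A>"
    and Dist_tens_right: "\<lbrakk>D \<in> Ob \<A>; (A, B, C, f, g, h) \<in> Dist \<A>\<rbrakk> \<Longrightarrow>
      (A \<otimes>\<^sub>o D, B \<otimes>\<^sub>o D, C \<otimes>\<^sub>o D, f \<otimes>\<^sub>m ident \<A> D, g \<otimes>\<^sub>m ident \<A> D,
        shift_out_left \<A> A D \<cdot> (h \<otimes>\<^sub>m ident \<A> D)) \<in> Dist \<A>"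


section \<open>Complementary idempotents\<close>

text \<open>
  When the following holds, \<open>(U, \<eta>)\<close> is a unital idempotent, \<open>(C, \<epsilon>)\<close> is a counital idempotent,
  and each is the complementary idempotent of the other.
\<close>

definition complementary_idempotents ::
    "('o, 'm, 'x) tensor_triangulated_scheme \<Rightarrow> 'o \<Rightarrow> 'o \<Rightarrow> 'm \<Rightarrow> 'm \<Rightarrow> 'm \<Rightarrow> bool" where
  "complementary_idempotents \<A> C U \<epsilon> \<eta> \<delta> \<longleftrightarrow>
     C \<in> Ob \<A> \<and> U \<in> Ob \<A> \<and>
     iso_zero \<A> (C \<otimes>\<^sub>o\<^bsub>\<A>\<^esub> U) \<and> iso_zero \<A> (U \<otimes>\<^sub>o\<^bsub>\<A>\<^esub> C) \<and>
     (C, \<one>\<^sub>o\<^bsub>\<A>\<^esub>, U, \<epsilon>, \<eta>, \<delta>) \<in> Dist \<A>"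

end

(* Everything is controlled by the vanishing of C1 * U2, where * is the tensor product.
   Tensoring the first triangle with U2 shows that C1 * U2 = 0 iff U1 * U2 is isomorphic to U2, and
   tensoring the second one with C1 shows that C1 * U2 = 0 iff C1 * C2 is isomorphic to C1.  Whenever
   U1 * X = 0 and C1 * Y = 0 there are no nonzero maps X -> Y; hence C1 * U2 = 0 forces
   eta2 o eps1 = 0, which is equivalent to the existence of nu and to that of theta.  Conversely, nu
   exhibits U2 as a retract of U1 * U2, which is annihilated by C1.  The obstructions to uniqueness
   of nu and theta are maps C1[1] -> U2, so they vanish as well.  The same argument with the tensor
   factors reversed deals with U2 * C1. *)

theory Submission
  imports Defs
begin

section \<open>Isomorphisms and retracts\<close>

context category
begin

lemma iso_morD:
  assumes "iso_mor \<A> A B f"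
  obtains g where "f \<in> Hom \<A> A B" "g \<in> Hom \<A> B A" "g \<cdot> f = ident \<A> A" "f \<cdot> g = ident \<A> B"
  using assms unfolding iso_mor_def inverse_mors_def by blast

lemma iso_objI:
  assumes "f \<in> Hom \<A> A B" "g \<in> Hom \<A> B A" "g \<cdot> f = ident \<A> A" "f \<cdot> g = ident \<A> B"
  shows "A \<simeq> B"
  using assms unfolding iso_obj_def iso_mor_def inverse_mors_def by blast

lemma iso_objE:
  assumes "A \<simeq> B"
  obtains f g where "f \<in> Hom \<A> A B" "g \<in> Hom \<A> B A" "g \<cdot> f = ident \<A> A" "f \<cdot> g = ident \<A> B"
  using assms unfolding iso_obj_def iso_mor_def inverse_mors_def by blast

lemma iso_obj_sym: "A \<simeq> B \<Longrightarrow> B \<simeq> A"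
  by (meson iso_objE iso_objI)

text \<open>Stated for one-sided inverses so that it serves twice: in both directions for composites
  of isomorphisms, and later to exhibit \<open>U\<^sub>2\<close> as a retract of
  \<open>U\<^sub>1 \<odot> U\<^sub>2\<close>.\<close>

lemma retract_trans:
  assumes ob: "A \<in> Ob \<A>" "B \<in> Ob \<A>" "C \<in> Ob \<A>"
    and f: "f \<in> Hom \<A> A B" "g \<in> Hom \<A> B A" "g \<cdot> f = ident \<A> A"
    and h: "h \<in> Hom \<A> B C" "k \<in> Hom \<A> C B" "k \<cdot> h = ident \<A> B"
  shows "(g \<cdot> k) \<cdot> (h \<cdot> f) = ident \<A> A"
proof -
  have "(g \<cdot> k) \<cdot> (h \<cdot> f) = g \<cdot> (k \<cdot> (h \<cdot> f))"
    using ob f h comp_in[OF ob f(1) h(1)] by (intro comp_assoc[of A C B A])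
  also have "k \<cdot> (h \<cdot> f) = f"
    using ob f h comp_assoc[OF ob(1,2,3,2) f(1) h(1) h(2)] ident_comp[OF ob(1,2) f(1)] by simp
  finally show ?thesis
    using f(3) by simp
qed

lemma iso_obj_trans:
  assumes ob: "A \<in> Ob \<A>" "B \<in> Ob \<A>" "C \<in> Ob \<A>" and "A \<simeq> B" "B \<simeq> C"
  shows "A \<simeq> C"
proof -
  obtain f g where f: "f \<in> Hom \<A> A B" "g \<in> Hom \<A> B A" "g \<cdot> f = ident \<A> A" "f \<cdot> g = ident \<A> B"
    using \<open>A \<simeq> B\<close> by (rule iso_objE)
  obtain h k where h: "h \<in> Hom \<A> B C" "k \<in> Hom \<A> C B" "k \<cdot> h = ident \<A> B" "h \<cdot> k = ident \<A> C"
    using \<open>B \<simeq> C\<close> by (rule iso_objE)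
  show ?thesis
    using comp_in[OF ob f(1) h(1)] comp_in[OF ob(3,2,1) h(2) f(2)]
      retract_trans[OF ob f(1-3) h(1-3)] retract_trans[OF ob(3,2,1) h(2,1,4) f(2,1,4)]
    by (rule iso_objI)
qed

text \<open>Associativity gives \<open>g = g \<cdot> f \<cdot> g' = g'\<close>. Exactness of a
  triangle delivers the left and the right inverse by separate arguments, which this
  reconciles.\<close>

lemma iso_objI_one_sided:
  assumes ob: "A \<in> Ob \<A>" "B \<in> Ob \<A>"
    and f: "f \<in> Hom \<A> A B" "g \<in> Hom \<A> B A" "g' \<in> Hom \<A> B A"
    and "g \<cdot> f = ident \<A> A" "f \<cdot> g' = ident \<A> B"
  shows "A \<simeq> B"
proof -
  have "g = (g \<cdot> f) \<cdot> g'"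
    using assms comp_assoc[OF ob(2,1,2,1) f(3,1,2)] comp_ident[OF ob(2,1) f(2)] by simp
  hence "g = g'"
    using assms ident_comp[OF ob(2,1) f(3)] by simp
  thus ?thesis
    using assms by (auto intro: iso_objI)
qed

end

section \<open>Sums, zero objects and cancellation\<close>

context additive_category
begin

lemma zero_mor_in: "\<lbrakk>A \<in> Ob \<A>; B \<in> Ob \<A>\<rbrakk> \<Longrightarrow> zero_mor \<A> A B \<in> Hom \<A> A B"
  using monoid.one_closed[OF comm_group.axioms(1)[THEN comm_monoid.axioms(1)], OF hom_comm_group]
  by (simp add: hom_group_def)

lemma neg_mor_in: "\<lbrakk>A \<in> Ob \<A>; B \<in> Ob \<A>; f \<in> Hom \<A> A B\<rbrakk> \<Longrightarrow> neg_mor \<A> A B f \<in> Hom \<A> A B"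
  using group.inv_closed[OF comm_group.axioms(2), OF hom_comm_group, of A B f]
  by (simp add: hom_group_def neg_mor_def)

lemma zero_mor_unique:
  assumes "A \<in> Ob \<A>" "B \<in> Ob \<A>" "f \<in> Hom \<A> A B" "g \<in> Hom \<A> A B" "f = f \<oplus>\<^sub>m g"
  shows "g = zero_mor \<A> A B"
proof -
  interpret comm_group "hom_group \<A> A B" using assms hom_comm_group by blast
  show ?thesis
    using l_cancel_one'[of f g] assms by (simp add: hom_group_def)
qed

text \<open>Subtraction in existential form, with witness \<open>-g + f\<close>. It reduces the
  equality of two maps to the vanishing of one.\<close>

lemma ex_difference:
  assumes "A \<in> Ob \<A>" "B \<in> Ob \<A>" "f \<in> Hom \<A> A B" "g \<in> Hom \<A> A B"
  shows "\<exists>d\<in>Hom \<A> A B. f = g \<oplus>\<^sub>m d"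
proof -
  interpret comm_group "hom_group \<A> A B" using assms hom_comm_group by blast
  let ?d = "inv\<^bsub>hom_group \<A> A B\<^esub> g \<otimes>\<^bsub>hom_group \<A> A B\<^esub> f"
  have fg: "f \<in> carrier (hom_group \<A> A B)" "g \<in> carrier (hom_group \<A> A B)"
    using assms by (simp_all add: hom_group_def)
  hence "?d \<in> carrier (hom_group \<A> A B)" "f = g \<otimes>\<^bsub>hom_group \<A> A B\<^esub> ?d"
    by (simp_all add: m_assoc[symmetric])
  thus ?thesis
    by (auto simp: hom_group_def)
qed

lemma zero_add_zero:
  "\<lbrakk>A \<in> Ob \<A>; B \<in> Ob \<A>\<rbrakk> \<Longrightarrow> zero_mor \<A> A B \<oplus>\<^sub>m zero_mor \<A> A B = zero_mor \<A> A B"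
  using monoid.l_one[OF comm_group.axioms(1)[THEN comm_monoid.axioms(1)], OF hom_comm_group,
      of A B "zero_mor \<A> A B"] zero_mor_in[of A B]
  by (simp add: hom_group_def)

lemma add_eq_zero_iff:
  assumes "A \<in> Ob \<A>" "B \<in> Ob \<A>" "f \<in> Hom \<A> A B" "g \<in> Hom \<A> A B"
  shows "f \<oplus>\<^sub>m g = zero_mor \<A> A B \<longleftrightarrow> g = neg_mor \<A> A B f"
proof -
  interpret comm_group "hom_group \<A> A B" using assms hom_comm_group by blast
  have fg: "f \<in> carrier (hom_group \<A> A B)" "g \<in> carrier (hom_group \<A> A B)"
    using assms by (simp_all add: hom_group_def)
  have "f \<otimes>\<^bsub>hom_group \<A> A B\<^esub> g = \<one>\<^bsub>hom_group \<A> A B\<^esub> \<longleftrightarrow> g = inv\<^bsub>hom_group \<A> A B\<^esub> f"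
    using fg by (metis inv_equality l_inv m_comm inv_closed)
  thus ?thesis
    by (simp add: hom_group_def neg_mor_def)
qed

lemma neg_mor_inject:
  assumes "A \<in> Ob \<A>" "B \<in> Ob \<A>" "f \<in> Hom \<A> A B" "g \<in> Hom \<A> A B"
  shows "neg_mor \<A> A B f = neg_mor \<A> A B g \<longleftrightarrow> f = g"
proof -
  interpret comm_group "hom_group \<A> A B" using assms hom_comm_group by blast
  have "f \<in> carrier (hom_group \<A> A B)" "g \<in> carrier (hom_group \<A> A B)"
    using assms by (simp_all add: hom_group_def)
  thus ?thesis
    unfolding neg_mor_def by (metis inv_inv)
qed

lemma comp_zero:
  assumes ob: "A \<in> Ob \<A>" "B \<in> Ob \<A>" "C \<in> Ob \<A>" and f: "f \<in> Hom \<A> B C"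
  shows "f \<cdot> zero_mor \<A> A B = zero_mor \<A> A C"
proof -
  note 0 = zero_mor_in[OF ob(1,2)]
  note f0 = comp_in[OF ob 0 f]
  have "f \<cdot> zero_mor \<A> A B = f \<cdot> zero_mor \<A> A B \<oplus>\<^sub>m f \<cdot> zero_mor \<A> A B"
    using comp_add_right[OF ob 0 0 f] zero_add_zero[OF ob(1,2)] by simp
  thus ?thesis
    by (rule zero_mor_unique[OF ob(1,3) f0 f0])
qed

lemma zero_comp:
  assumes ob: "A \<in> Ob \<A>" "B \<in> Ob \<A>" "C \<in> Ob \<A>" and f: "f \<in> Hom \<A> A B"
  shows "zero_mor \<A> B C \<cdot> f = zero_mor \<A> A C"
proof -
  note 0 = zero_mor_in[OF ob(2,3)]
  note f0 = comp_in[OF ob f 0]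
  have "zero_mor \<A> B C \<cdot> f = zero_mor \<A> B C \<cdot> f \<oplus>\<^sub>m zero_mor \<A> B C \<cdot> f"
    using comp_add_left[OF ob f 0 0] zero_add_zero[OF ob(2,3)] by simp
  thus ?thesis
    by (rule zero_mor_unique[OF ob(1,3) f0 f0])
qed

lemma comp_neg:
  assumes ob: "A \<in> Ob \<A>" "B \<in> Ob \<A>" "C \<in> Ob \<A>" and f: "f \<in> Hom \<A> A B" and g: "g \<in> Hom \<A> B C"
  shows "g \<cdot> neg_mor \<A> A B f = neg_mor \<A> A C (g \<cdot> f)"
  using comp_add_right[OF ob f neg_mor_in[OF ob(1,2) f] g] add_eq_zero_iff[OF ob(1,2) f neg_mor_in[OF ob(1,2) f]]
    add_eq_zero_iff[OF ob(1,3) comp_in[OF ob f g] comp_in[OF ob neg_mor_in[OF ob(1,2) f] g]] comp_zero[OF ob g]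
  by simp

lemma neg_comp:
  assumes ob: "A \<in> Ob \<A>" "B \<in> Ob \<A>" "C \<in> Ob \<A>" and f: "f \<in> Hom \<A> A B" and g: "g \<in> Hom \<A> B C"
  shows "neg_mor \<A> B C g \<cdot> f = neg_mor \<A> A C (g \<cdot> f)"
  using comp_add_left[OF ob f g neg_mor_in[OF ob(2,3) g]] add_eq_zero_iff[OF ob(2,3) g neg_mor_in[OF ob(2,3) g]]
    add_eq_zero_iff[OF ob(1,3) comp_in[OF ob f g] comp_in[OF ob f neg_mor_in[OF ob(2,3) g]]] zero_comp[OF ob f]
  by simp

text \<open>If the identity vanishes, so does every map into or out of \<open>A\<close>, being its
  own composite with that identity. The equational form lets suspension and tensoring be checked on
  the identity alone.\<close>

lemma zero_object_iff: "zero_object \<A> A \<longleftrightarrow> A \<in> Ob \<A> \<and> ident \<A> A = zero_mor \<A> A A"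
proof (intro iffI conjI)
  assume A: "zero_object \<A> A"
  thus "A \<in> Ob \<A>"
    by (simp add: zero_object_def)
  with A show "ident \<A> A = zero_mor \<A> A A"
    using ident_in zero_mor_in unfolding zero_object_def by blast
next
  assume A: "A \<in> Ob \<A> \<and> ident \<A> A = zero_mor \<A> A A"
  have "f = zero_mor \<A> B A" if "B \<in> Ob \<A>" "f \<in> Hom \<A> B A" for B f
    using that A ident_comp[of B A f] zero_comp[of B A A f] by simp
  moreover have "f = zero_mor \<A> A B" if "B \<in> Ob \<A>" "f \<in> Hom \<A> A B" for B f
    using that A comp_ident[of A B f] comp_zero[of A A B f] by simp
  ultimately show "zero_object \<A> A"
    unfolding zero_object_def using A zero_mor_in by blast
qed

lemma zero_object_in: "zero_object \<A> A \<Longrightarrow> A \<in> Ob \<A>"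
  by (simp add: zero_object_def)

lemma to_zero_object:
  "\<lbrakk>zero_object \<A> B; A \<in> Ob \<A>; f \<in> Hom \<A> A B\<rbrakk> \<Longrightarrow> f = zero_mor \<A> A B"
  using zero_mor_in unfolding zero_object_def by blast

lemma from_zero_object:
  "\<lbrakk>zero_object \<A> A; B \<in> Ob \<A>; f \<in> Hom \<A> A B\<rbrakk> \<Longrightarrow> f = zero_mor \<A> A B"
  using zero_mor_in unfolding zero_object_def by blast

text \<open>The identity of \<open>A\<close> factors through a zero object, hence is zero.\<close>

lemma zero_object_retract:
  assumes "zero_object \<A> B" "A \<in> Ob \<A>" "s \<in> Hom \<A> A B" "p \<in> Hom \<A> B A" "p \<cdot> s = ident \<A> A"
  shows "zero_object \<A> A"
  using assms to_zero_object[of B A s] comp_zero[of A B A p] zero_object_in[of B]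
  by (auto simp: zero_object_iff)

lemma zero_object_iso: "\<lbrakk>zero_object \<A> B; A \<in> Ob \<A>; A \<simeq> B\<rbrakk> \<Longrightarrow> zero_object \<A> A"
  by (meson iso_objE zero_object_retract)

lemma iso_zero_imp_zero_object: "\<lbrakk>iso_zero \<A> A; A \<in> Ob \<A>\<rbrakk> \<Longrightarrow> zero_object \<A> A"
  unfolding iso_zero_def using zero_object_iso by blast

text \<open>The difference \<open>d\<close> of \<open>f\<close> and \<open>f'\<close> is killed by
  \<open>g\<close>, so \<open>mono\<close> applies to it. Uniqueness claims thereby reduce to the
  vanishing of a map.\<close>

lemma cancel_left:
  assumes ob: "A \<in> Ob \<A>" "B \<in> Ob \<A>" "C \<in> Ob \<A>" and g: "g \<in> Hom \<A> B C"
    and mono: "\<And>d. \<lbrakk>d \<in> Hom \<A> A B; g \<cdot> d = zero_mor \<A> A C\<rbrakk> \<Longrightarrow> d = zero_mor \<A> A B"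
    and f: "f \<in> Hom \<A> A B" "f' \<in> Hom \<A> A B" "g \<cdot> f = g \<cdot> f'"
  shows "f = f'"
proof -
  obtain d where d: "d \<in> Hom \<A> A B" "f = f' \<oplus>\<^sub>m d"
    using ex_difference[OF ob(1,2) f(1,2)] by blast
  have "g \<cdot> f' = g \<cdot> f' \<oplus>\<^sub>m g \<cdot> d"
    using comp_add_right[OF ob f(2) d(1) g] d(2) f(3) by simp
  hence "d = zero_mor \<A> A B"
    using mono[OF d(1)] zero_mor_unique[OF ob(1,3) comp_in[OF ob f(2) g] comp_in[OF ob d(1) g]] by blast
  \<comment> \<open>\<open>e\<close> is the zero map in disguise: cancellation forces this, and
    \<open>f' = f' \<oplus>\<^sub>m e\<close> then expresses the neutrality of zero, so that
    \<open>f = f'\<close>.\<close>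
  moreover obtain e where e: "e \<in> Hom \<A> A B" "f' = f' \<oplus>\<^sub>m e"
    using ex_difference[OF ob(1,2) f(2,2)] by blast
  ultimately show ?thesis
    using d zero_mor_unique[OF ob(1,2) f(2) e] by simp
qed

lemma cancel_right:
  assumes ob: "A \<in> Ob \<A>" "B \<in> Ob \<A>" "C \<in> Ob \<A>" and g: "g \<in> Hom \<A> A B"
    and epi: "\<And>d. \<lbrakk>d \<in> Hom \<A> B C; d \<cdot> g = zero_mor \<A> A C\<rbrakk> \<Longrightarrow> d = zero_mor \<A> B C"
    and f: "f \<in> Hom \<A> B C" "f' \<in> Hom \<A> B C" "f \<cdot> g = f' \<cdot> g"
  shows "f = f'"
proof -
  obtain d where d: "d \<in> Hom \<A> B C" "f = f' \<oplus>\<^sub>m d"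
    using ex_difference[OF ob(2,3) f(1,2)] by blast
  have "f' \<cdot> g = f' \<cdot> g \<oplus>\<^sub>m d \<cdot> g"
    using comp_add_left[OF ob g f(2) d(1)] d(2) f(3) by simp
  hence "d = zero_mor \<A> B C"
    using epi[OF d(1)] zero_mor_unique[OF ob(1,3) comp_in[OF ob g f(2)] comp_in[OF ob g d(1)]] by blast
  moreover obtain e where e: "e \<in> Hom \<A> B C" "f' = f' \<oplus>\<^sub>m e"
    using ex_difference[OF ob(2,3) f(2,2)] by blast
  ultimately show ?thesis
    using d zero_mor_unique[OF ob(2,3) f(2) e] by simp
qed

end

section \<open>Exactness properties of distinguished triangles\<close>

context triangulated_category
begin

lemma Dist_Ob:
  assumes "(A, B, C, f, g, h) \<in> Dist \<A>"
  shows "A \<in> Ob \<A>" "B \<in> Ob \<A>" "C \<in> Ob \<A>"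
  using Dist_triangle[OF assms] by auto

lemma Dist_Hom:
  assumes "(A, B, C, f, g, h) \<in> Dist \<A>"
  shows "f \<in> Hom \<A> A B" "g \<in> Hom \<A> B C" "h \<in> Hom \<A> C (A\<lbrakk>1\<rbrakk>\<^sub>o)"
  using Dist_triangle[OF assms] by auto

lemma shift_obj_in: "A \<in> Ob \<A> \<Longrightarrow> A\<lbrakk>1\<rbrakk>\<^sub>o \<in> Ob \<A>"
  using shift_obj_bij bij_betwE by blast

lemma shift_mor_in: "\<lbrakk>A \<in> Ob \<A>; B \<in> Ob \<A>; f \<in> Hom \<A> A B\<rbrakk> \<Longrightarrow> f\<lbrakk>1\<rbrakk>\<^sub>m \<in> Hom \<A> (A\<lbrakk>1\<rbrakk>\<^sub>o) (B\<lbrakk>1\<rbrakk>\<^sub>o)"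
  using shift_mor_bij bij_betwE by blast

lemma shift_mor_full:
  assumes "A \<in> Ob \<A>" "B \<in> Ob \<A>" "k \<in> Hom \<A> (A\<lbrakk>1\<rbrakk>\<^sub>o) (B\<lbrakk>1\<rbrakk>\<^sub>o)"
  obtains f where "f \<in> Hom \<A> A B" "k = f\<lbrakk>1\<rbrakk>\<^sub>m"
  using bij_betw_imp_surj_on[OF shift_mor_bij[OF assms(1,2)]] assms(3) by blast

lemma shift_mor_inject:
  "\<lbrakk>A \<in> Ob \<A>; B \<in> Ob \<A>; f \<in> Hom \<A> A B; g \<in> Hom \<A> A B; f\<lbrakk>1\<rbrakk>\<^sub>m = g\<lbrakk>1\<rbrakk>\<^sub>m\<rbrakk> \<Longrightarrow> f = g"
  using bij_betw_imp_inj_on[OF shift_mor_bij] inj_onD by metis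

lemma shift_zero:
  assumes ob: "A \<in> Ob \<A>" "B \<in> Ob \<A>"
  shows "(zero_mor \<A> A B)\<lbrakk>1\<rbrakk>\<^sub>m = zero_mor \<A> (A\<lbrakk>1\<rbrakk>\<^sub>o) (B\<lbrakk>1\<rbrakk>\<^sub>o)"
proof -
  note 0 = zero_mor_in[OF ob]
  note s0 = shift_mor_in[OF ob 0]
  have "(zero_mor \<A> A B)\<lbrakk>1\<rbrakk>\<^sub>m = (zero_mor \<A> A B)\<lbrakk>1\<rbrakk>\<^sub>m \<oplus>\<^sub>m (zero_mor \<A> A B)\<lbrakk>1\<rbrakk>\<^sub>m"
    using shift_add[OF ob 0 0] zero_add_zero[OF ob] by simp
  thus ?thesis
    by (rule zero_mor_unique[OF shift_obj_in[OF ob(1)] shift_obj_in[OF ob(2)] s0 s0])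
qed

lemma shift_zero_object: "zero_object \<A> A \<Longrightarrow> zero_object \<A> (A\<lbrakk>1\<rbrakk>\<^sub>o)"
  using shift_zero[of A A] shift_ident[of A] shift_obj_in[of A] by (simp add: zero_object_iff)

lemma Dist_rotate_forward:
  assumes "(A, B, C, f, g, h) \<in> Dist \<A>"
  shows "(B, C, A\<lbrakk>1\<rbrakk>\<^sub>o, g, h, neg_mor \<A> (A\<lbrakk>1\<rbrakk>\<^sub>o) (B\<lbrakk>1\<rbrakk>\<^sub>o) (f\<lbrakk>1\<rbrakk>\<^sub>m)) \<in> Dist \<A>"
  using assms Dist_rotate[OF Dist_triangle[OF assms]] by simp

text \<open>Completing \<open>ident \<A> A\<close> and \<open>f\<close> to a morphism out of the
  identity triangle of \<open>A\<close> makes the composite factor through the zero object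
  \<open>Z\<close>.\<close>

lemma Dist_comp_zero:
  assumes T: "(A, B, C, f, g, h) \<in> Dist \<A>"
  shows "g \<cdot> f = zero_mor \<A> A C"
proof -
  note ob = Dist_Ob[OF T] and hom = Dist_Hom[OF T]
  obtain Z where Z: "zero_object \<A> Z"
    using ex_zero_object by blast
  obtain c where "triangle_mor \<A> (A, A, Z, ident \<A> A, zero_mor \<A> A Z, zero_mor \<A> Z (A\<lbrakk>1\<rbrakk>\<^sub>o))
      (A, B, C, f, g, h) (ident \<A> A) f c"
    using Dist_complete[OF Dist_ident[OF ob(1) Z] T ident_in[OF ob(1)] hom(1)] by blast
  thus ?thesis
    using comp_zero[OF ob(1) zero_object_in[OF Z] ob(3), of c] by simp
qed

text \<open>Exactness of Hom(X, -) at \<open>B\<close>. The identity triangle of \<open>X\<close>,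
  rotated once, maps to the rotated \<open>T\<close> by \<open>u\<close> and zero; the third
  component is the suspension of the desired lift.\<close>

lemma lift_through_fst:
  assumes T: "(A, B, C, f, g, h) \<in> Dist \<A>"
    and X: "X \<in> Ob \<A>" "u \<in> Hom \<A> X B" "g \<cdot> u = zero_mor \<A> X C"
  obtains v where "v \<in> Hom \<A> X A" "f \<cdot> v = u"
proof -
  note ob = Dist_Ob[OF T] and hom = Dist_Hom[OF T]
  obtain Z where Z: "zero_object \<A> Z"
    using ex_zero_object by blast
  note obZ = zero_object_in[OF Z]
  note sX = shift_obj_in[OF X(1)] and sA = shift_obj_in[OF ob(1)] and sB = shift_obj_in[OF ob(2)]
  note su = shift_mor_in[OF X(1) ob(2) X(2)] and sf = shift_mor_in[OF ob(1,2) hom(1)]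
  have "zero_mor \<A> Z C \<cdot> zero_mor \<A> X Z = g \<cdot> u"
    using X(3) zero_comp[OF X(1) obZ ob(3)] zero_mor_in[OF X(1) obZ] by simp
  then obtain c where c: "c \<in> Hom \<A> (X\<lbrakk>1\<rbrakk>\<^sub>o) (A\<lbrakk>1\<rbrakk>\<^sub>o)"
    and eq: "u\<lbrakk>1\<rbrakk>\<^sub>m \<cdot> neg_mor \<A> (X\<lbrakk>1\<rbrakk>\<^sub>o) (X\<lbrakk>1\<rbrakk>\<^sub>o) ((ident \<A> X)\<lbrakk>1\<rbrakk>\<^sub>m) =
      neg_mor \<A> (A\<lbrakk>1\<rbrakk>\<^sub>o) (B\<lbrakk>1\<rbrakk>\<^sub>o) (f\<lbrakk>1\<rbrakk>\<^sub>m) \<cdot> c"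
    using Dist_complete[OF Dist_rotate_forward[OF Dist_ident[OF X(1) Z]] Dist_rotate_forward[OF T]
        X(2) zero_mor_in[OF obZ ob(3)]] by auto
  \<comment> \<open>Each side of \<open>eq\<close> carries one minus sign from the rotation, and
    negation is injective.\<close>
  have "u\<lbrakk>1\<rbrakk>\<^sub>m = f\<lbrakk>1\<rbrakk>\<^sub>m \<cdot> c"
    using eq comp_neg[OF sX sX sB ident_in[OF sX] su] neg_comp[OF sX sA sB c sf]
      neg_mor_inject[OF sX sB su comp_in[OF sX sA sB c sf]] comp_ident[OF sX sB su] shift_ident[OF X(1)]
    by simp
  moreover obtain v where v: "v \<in> Hom \<A> X A" "c = v\<lbrakk>1\<rbrakk>\<^sub>m"
    using shift_mor_full[OF X(1) ob(1) c] .
  ultimately have "(f \<cdot> v)\<lbrakk>1\<rbrakk>\<^sub>m = u\<lbrakk>1\<rbrakk>\<^sub>m"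
    using shift_comp[OF X(1) ob(1,2) v(1) hom(1)] by simp
  thus ?thesis
    using that v(1) shift_mor_inject[OF X(1) ob(2) comp_in[OF X(1) ob(1,2) v(1) hom(1)] X(2)] by blast
qed

text \<open>Dually, exactness of Hom(-, X) at \<open>B\<close>. \<open>T\<close> maps by zero and
  \<open>u\<close> to a triangle \<open>Z -> X -> X\<close> whose second map is the identity; the
  third component is the extension.\<close>

lemma extend_along_snd:
  assumes T: "(A, B, C, f, g, h) \<in> Dist \<A>"
    and X: "X \<in> Ob \<A>" "u \<in> Hom \<A> B X" "u \<cdot> f = zero_mor \<A> A X"
  obtains v where "v \<in> Hom \<A> C X" "v \<cdot> g = u"
proof -
  note ob = Dist_Ob[OF T] and hom = Dist_Hom[OF T]
  obtain Z where Z: "zero_object \<A> Z"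
    using ex_zero_object by blast
  note obZ = zero_object_in[OF Z]
  note sZ = shift_zero_object[OF Z] and sX = shift_obj_in[OF X(1)]
  note obsZ = zero_object_in[OF sZ]
  \<comment> \<open>The identity triangle of \<open>X\<close> is taken with the suspended zero
    object, so that it is literally a rotation of \<open>D\<close> and \<open>Dist_rotate\<close>
    can be read backwards. This requires the rotated last map to be zero, sign included.\<close>
  have "neg_mor \<A> (Z\<lbrakk>1\<rbrakk>\<^sub>o) (X\<lbrakk>1\<rbrakk>\<^sub>o) ((zero_mor \<A> Z X)\<lbrakk>1\<rbrakk>\<^sub>m) = zero_mor \<A> (Z\<lbrakk>1\<rbrakk>\<^sub>o) (X\<lbrakk>1\<rbrakk>\<^sub>o)"
    by (intro from_zero_object[OF sZ sX] neg_mor_in[OF obsZ sX] shift_mor_in[OF obZ X(1)]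
        zero_mor_in[OF obZ X(1)])
  hence D: "(Z, X, X, zero_mor \<A> Z X, ident \<A> X, zero_mor \<A> X (Z\<lbrakk>1\<rbrakk>\<^sub>o)) \<in> Dist \<A>"
    using Dist_rotate[of Z X X "zero_mor \<A> Z X" "ident \<A> X" "zero_mor \<A> X (Z\<lbrakk>1\<rbrakk>\<^sub>o)"]
      Dist_ident[OF X(1) sZ] obZ X(1) obsZ by (simp add: zero_mor_in ident_in)
  have "u \<cdot> f = zero_mor \<A> Z X \<cdot> zero_mor \<A> A Z"
    using X(3) zero_comp[OF ob(1) obZ X(1)] zero_mor_in[OF ob(1) obZ] by simp
  then obtain v where "v \<in> Hom \<A> C X" "v \<cdot> g = ident \<A> X \<cdot> u"
    using Dist_complete[OF T D zero_mor_in[OF ob(1) obZ] X(2)] by auto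
  thus ?thesis
    using that ident_comp[OF ob(2) X(1,2)] by simp
qed

text \<open>Two rotations put \<open>h\<close> first, followed by the negated suspension of
  \<open>f\<close>, so \<open>lift_through_fst\<close> applies. Testing with the suspension of
  \<open>X\<close> avoids desuspending \<open>C\<close>.\<close>

lemma lift_shift_through_third:
  assumes T: "(A, B, C, f, g, h) \<in> Dist \<A>"
    and X: "X \<in> Ob \<A>" "u \<in> Hom \<A> X A" "f \<cdot> u = zero_mor \<A> X B"
  obtains v where "v \<in> Hom \<A> (X\<lbrakk>1\<rbrakk>\<^sub>o) C" "h \<cdot> v = u\<lbrakk>1\<rbrakk>\<^sub>m"
proof -
  note ob = Dist_Ob[OF T] and hom = Dist_Hom[OF T]
  note sX = shift_obj_in[OF X(1)] and sA = shift_obj_in[OF ob(1)] and sB = shift_obj_in[OF ob(2)]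
  note su = shift_mor_in[OF X(1) ob(1) X(2)] and sf = shift_mor_in[OF ob(1,2) hom(1)]
  have "f\<lbrakk>1\<rbrakk>\<^sub>m \<cdot> u\<lbrakk>1\<rbrakk>\<^sub>m = zero_mor \<A> (X\<lbrakk>1\<rbrakk>\<^sub>o) (B\<lbrakk>1\<rbrakk>\<^sub>o)"
    using shift_comp[OF X(1) ob(1,2) X(2) hom(1)] X(3) shift_zero[OF X(1) ob(2)] by simp
  hence "neg_mor \<A> (A\<lbrakk>1\<rbrakk>\<^sub>o) (B\<lbrakk>1\<rbrakk>\<^sub>o) (f\<lbrakk>1\<rbrakk>\<^sub>m) \<cdot> u\<lbrakk>1\<rbrakk>\<^sub>m = zero_mor \<A> (X\<lbrakk>1\<rbrakk>\<^sub>o) (B\<lbrakk>1\<rbrakk>\<^sub>o)"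
    using neg_comp[OF sX sA sB su sf] zero_add_zero[OF sX sB]
      add_eq_zero_iff[OF sX sB zero_mor_in[OF sX sB] zero_mor_in[OF sX sB]] by simp
  thus ?thesis
    using lift_through_fst[OF Dist_rotate_forward[OF Dist_rotate_forward[OF T]] sX su] that by blast
qed

text \<open>With \<open>C\<close> zero, \<open>h\<close> is zero too, so in the twice rotated
  triangle the identity of the suspended \<open>A\<close> extends along the negated suspension of
  \<open>f\<close>. Correcting the sign and desuspending gives \<open>p\<close>.\<close>

lemma fst_left_inverse:
  assumes T: "(A, B, C, f, g, h) \<in> Dist \<A>" and C: "zero_object \<A> C"
  obtains p where "p \<in> Hom \<A> B A" "p \<cdot> f = ident \<A> A"
proof -
  note ob = Dist_Ob[OF T] and hom = Dist_Hom[OF T]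
  note sA = shift_obj_in[OF ob(1)] and sB = shift_obj_in[OF ob(2)]
  note sf = shift_mor_in[OF ob(1,2) hom(1)]
  have "ident \<A> (A\<lbrakk>1\<rbrakk>\<^sub>o) \<cdot> h = zero_mor \<A> C (A\<lbrakk>1\<rbrakk>\<^sub>o)"
    using from_zero_object[OF C sA] hom(3) ident_comp[OF ob(3) sA hom(3)] by simp
  then obtain q where q: "q \<in> Hom \<A> (B\<lbrakk>1\<rbrakk>\<^sub>o) (A\<lbrakk>1\<rbrakk>\<^sub>o)"
      "q \<cdot> neg_mor \<A> (A\<lbrakk>1\<rbrakk>\<^sub>o) (B\<lbrakk>1\<rbrakk>\<^sub>o) (f\<lbrakk>1\<rbrakk>\<^sub>m) = ident \<A> (A\<lbrakk>1\<rbrakk>\<^sub>o)"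
    using extend_along_snd[OF Dist_rotate_forward[OF Dist_rotate_forward[OF T]] sA ident_in[OF sA]] by blast
  define q' where "q' = neg_mor \<A> (B\<lbrakk>1\<rbrakk>\<^sub>o) (A\<lbrakk>1\<rbrakk>\<^sub>o) q"
  have q': "q' \<in> Hom \<A> (B\<lbrakk>1\<rbrakk>\<^sub>o) (A\<lbrakk>1\<rbrakk>\<^sub>o)" "q' \<cdot> f\<lbrakk>1\<rbrakk>\<^sub>m = ident \<A> (A\<lbrakk>1\<rbrakk>\<^sub>o)"
    using q neg_mor_in[OF sB sA] comp_neg[OF sA sB sA sf q(1)] neg_comp[OF sA sB sA sf q(1)]
    by (simp_all add: q'_def)
  obtain p where p: "p \<in> Hom \<A> B A" "q' = p\<lbrakk>1\<rbrakk>\<^sub>m"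
    using shift_mor_full[OF ob(2,1) q'(1)] .
  have "(p \<cdot> f)\<lbrakk>1\<rbrakk>\<^sub>m = (ident \<A> A)\<lbrakk>1\<rbrakk>\<^sub>m"
    using q' p shift_comp[OF ob(1,2,1) hom(1) p(1)] shift_ident[OF ob(1)] by simp
  thus ?thesis
    using that p(1) shift_mor_inject[OF ob(1,1) comp_in[OF ob(1,2,1) hom(1) p(1)] ident_in[OF ob(1)]] by blast
qed

lemma Dist_fst_iso:
  assumes T: "(A, B, C, f, g, h) \<in> Dist \<A>" and C: "zero_object \<A> C"
  shows "A \<simeq> B"
proof -
  note ob = Dist_Ob[OF T] and hom = Dist_Hom[OF T]
  have "g \<cdot> ident \<A> B = zero_mor \<A> B C"
    using to_zero_object[OF C ob(2) hom(2)] comp_ident[OF ob(2,3) hom(2)] by simp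
  then obtain s where "s \<in> Hom \<A> B A" "f \<cdot> s = ident \<A> B"
    using lift_through_fst[OF T ob(2) ident_in[OF ob(2)]] by blast
  moreover obtain p where "p \<in> Hom \<A> B A" "p \<cdot> f = ident \<A> A"
    using fst_left_inverse[OF T C] .
  ultimately show ?thesis
    using iso_objI_one_sided[OF ob(1,2) hom(1)] by blast
qed

lemma Dist_snd_iso: "\<lbrakk>(A, B, C, f, g, h) \<in> Dist \<A>; zero_object \<A> A\<rbrakk> \<Longrightarrow> B \<simeq> C"
  using Dist_fst_iso[OF Dist_rotate_forward shift_zero_object] .

lemma Dist_third_zero:
  assumes T: "(A, B, C, f, g, h) \<in> Dist \<A>" and A: "zero_object \<A> A" and B: "zero_object \<A> B"
  shows "zero_object \<A> C"
  using zero_object_iso[OF B] Dist_snd_iso[OF T A] iso_obj_sym Dist_Ob(3)[OF T] by blast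

section \<open>Maps between triangles with a common middle object\<close>

text \<open>Both sides amount to the vanishing of
  \<open>\<eta>\<^sub>2 \<cdot> \<epsilon>\<^sub>1\<close>: then \<open>\<eta>\<^sub>2\<close>
  extends along \<open>\<eta>\<^sub>1\<close>, and \<open>\<epsilon>\<^sub>1\<close> lifts through
  \<open>\<epsilon>\<^sub>2\<close>.\<close>

lemma factor_iff_cofactor:
  assumes T1: "(C\<^sub>1, I, U\<^sub>1, \<epsilon>\<^sub>1, \<eta>\<^sub>1, \<delta>\<^sub>1) \<in> Dist \<A>" and T2: "(C\<^sub>2, I, U\<^sub>2, \<epsilon>\<^sub>2, \<eta>\<^sub>2, \<delta>\<^sub>2) \<in> Dist \<A>"
  shows "(\<exists>\<nu>\<in>Hom \<A> U\<^sub>1 U\<^sub>2. \<nu> \<cdot> \<eta>\<^sub>1 = \<eta>\<^sub>2) \<longleftrightarrow> (\<exists>\<theta>\<in>Hom \<A> C\<^sub>1 C\<^sub>2. \<epsilon>\<^sub>2 \<cdot> \<theta> = \<epsilon>\<^sub>1)"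
proof
  note ob1 = Dist_Ob[OF T1] and hom1 = Dist_Hom[OF T1]
  note ob2 = Dist_Ob[OF T2] and hom2 = Dist_Hom[OF T2]
  {
    assume "\<exists>\<nu>\<in>Hom \<A> U\<^sub>1 U\<^sub>2. \<nu> \<cdot> \<eta>\<^sub>1 = \<eta>\<^sub>2"
    then obtain \<nu> where \<nu>: "\<nu> \<in> Hom \<A> U\<^sub>1 U\<^sub>2" "\<nu> \<cdot> \<eta>\<^sub>1 = \<eta>\<^sub>2"
      by blast
    have "\<eta>\<^sub>2 \<cdot> \<epsilon>\<^sub>1 = zero_mor \<A> C\<^sub>1 U\<^sub>2"
      using comp_assoc[OF ob1 ob2(3) hom1(1,2) \<nu>(1)] \<nu>(2) Dist_comp_zero[OF T1]
        comp_zero[OF ob1(1,3) ob2(3) \<nu>(1)] by simp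
    then obtain \<theta> where "\<theta> \<in> Hom \<A> C\<^sub>1 C\<^sub>2" "\<epsilon>\<^sub>2 \<cdot> \<theta> = \<epsilon>\<^sub>1"
      by (rule lift_through_fst[OF T2 ob1(1) hom1(1)])
    thus "\<exists>\<theta>\<in>Hom \<A> C\<^sub>1 C\<^sub>2. \<epsilon>\<^sub>2 \<cdot> \<theta> = \<epsilon>\<^sub>1"
      by blast
  next
    assume "\<exists>\<theta>\<in>Hom \<A> C\<^sub>1 C\<^sub>2. \<epsilon>\<^sub>2 \<cdot> \<theta> = \<epsilon>\<^sub>1"
    then obtain \<theta> where \<theta>: "\<theta> \<in> Hom \<A> C\<^sub>1 C\<^sub>2" "\<epsilon>\<^sub>2 \<cdot> \<theta> = \<epsilon>\<^sub>1"
      by blast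
    have "\<eta>\<^sub>2 \<cdot> \<epsilon>\<^sub>1 = zero_mor \<A> C\<^sub>1 U\<^sub>2"
      using comp_assoc[OF ob1(1) ob2 \<theta>(1) hom2(1,2)] \<theta>(2) Dist_comp_zero[OF T2]
        zero_comp[OF ob1(1) ob2(1,3) \<theta>(1)] by simp
    then obtain \<nu> where "\<nu> \<in> Hom \<A> U\<^sub>1 U\<^sub>2" "\<nu> \<cdot> \<eta>\<^sub>1 = \<eta>\<^sub>2"
      by (rule extend_along_snd[OF T1 ob2(3) hom2(2)])
    thus "\<exists>\<nu>\<in>Hom \<A> U\<^sub>1 U\<^sub>2. \<nu> \<cdot> \<eta>\<^sub>1 = \<eta>\<^sub>2"
      by blast
  }
qed

text \<open>A map \<open>d\<close> that vanishes on \<open>\<eta>\<^sub>1\<close> factors through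
  \<open>\<delta>\<^sub>1\<close>, and the other factor is killed by \<open>orth\<close>.\<close>

lemma factor_unique:
  assumes T1: "(C\<^sub>1, I, U\<^sub>1, \<epsilon>\<^sub>1, \<eta>\<^sub>1, \<delta>\<^sub>1) \<in> Dist \<A>" and T2: "(C\<^sub>2, I, U\<^sub>2, \<epsilon>\<^sub>2, \<eta>\<^sub>2, \<delta>\<^sub>2) \<in> Dist \<A>"
    and orth: "\<And>f. f \<in> Hom \<A> (C\<^sub>1\<lbrakk>1\<rbrakk>\<^sub>o) U\<^sub>2 \<Longrightarrow> f = zero_mor \<A> (C\<^sub>1\<lbrakk>1\<rbrakk>\<^sub>o) U\<^sub>2"
    and "\<nu> \<in> Hom \<A> U\<^sub>1 U\<^sub>2" "\<nu>' \<in> Hom \<A> U\<^sub>1 U\<^sub>2" "\<nu> \<cdot> \<eta>\<^sub>1 = \<nu>' \<cdot> \<eta>\<^sub>1"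
  shows "\<nu> = \<nu>'"
proof -
  note ob1 = Dist_Ob[OF T1] and hom1 = Dist_Hom[OF T1]
  note U = Dist_Ob(3)[OF T2]
  have "d = zero_mor \<A> U\<^sub>1 U\<^sub>2" if d: "d \<in> Hom \<A> U\<^sub>1 U\<^sub>2" "d \<cdot> \<eta>\<^sub>1 = zero_mor \<A> I U\<^sub>2" for d
  proof -
    obtain v where v: "v \<in> Hom \<A> (C\<^sub>1\<lbrakk>1\<rbrakk>\<^sub>o) U\<^sub>2" "v \<cdot> \<delta>\<^sub>1 = d"
      using extend_along_snd[OF Dist_rotate_forward[OF T1] U d] .
    thus ?thesis
      using orth[OF v(1)] zero_comp[OF ob1(3) shift_obj_in[OF ob1(1)] U hom1(3)] by simp
  qed
  thus ?thesis
    by (rule cancel_right[OF ob1(2,3) U hom1(2) _ assms(4-6)])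
qed

text \<open>If \<open>\<epsilon>\<^sub>2 \<cdot> d\<close> vanishes, the suspension of
  \<open>d\<close> factors through \<open>\<delta>\<^sub>2\<close> by a map that \<open>orth\<close>
  kills; suspension is faithful, so \<open>d\<close> vanishes.\<close>

lemma cofactor_unique:
  assumes T1: "(C\<^sub>1, I, U\<^sub>1, \<epsilon>\<^sub>1, \<eta>\<^sub>1, \<delta>\<^sub>1) \<in> Dist \<A>" and T2: "(C\<^sub>2, I, U\<^sub>2, \<epsilon>\<^sub>2, \<eta>\<^sub>2, \<delta>\<^sub>2) \<in> Dist \<A>"
    and orth: "\<And>f. f \<in> Hom \<A> (C\<^sub>1\<lbrakk>1\<rbrakk>\<^sub>o) U\<^sub>2 \<Longrightarrow> f = zero_mor \<A> (C\<^sub>1\<lbrakk>1\<rbrakk>\<^sub>o) U\<^sub>2"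
    and "\<theta> \<in> Hom \<A> C\<^sub>1 C\<^sub>2" "\<theta>' \<in> Hom \<A> C\<^sub>1 C\<^sub>2" "\<epsilon>\<^sub>2 \<cdot> \<theta> = \<epsilon>\<^sub>2 \<cdot> \<theta>'"
  shows "\<theta> = \<theta>'"
proof -
  note ob2 = Dist_Ob[OF T2] and hom2 = Dist_Hom[OF T2]
  note C = Dist_Ob(1)[OF T1]
  have "d = zero_mor \<A> C\<^sub>1 C\<^sub>2" if d: "d \<in> Hom \<A> C\<^sub>1 C\<^sub>2" "\<epsilon>\<^sub>2 \<cdot> d = zero_mor \<A> C\<^sub>1 I" for d
  proof -
    obtain v where v: "v \<in> Hom \<A> (C\<^sub>1\<lbrakk>1\<rbrakk>\<^sub>o) U\<^sub>2" "\<delta>\<^sub>2 \<cdot> v = d\<lbrakk>1\<rbrakk>\<^sub>m"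
      using lift_shift_through_third[OF T2 C d] .
    hence "d\<lbrakk>1\<rbrakk>\<^sub>m = (zero_mor \<A> C\<^sub>1 C\<^sub>2)\<lbrakk>1\<rbrakk>\<^sub>m"
      using orth[OF v(1)] comp_zero[OF shift_obj_in[OF C] ob2(3) shift_obj_in[OF ob2(1)] hom2(3)]
        shift_zero[OF C ob2(1)] by simp
    thus ?thesis
      using shift_mor_inject[OF C ob2(1) d(1) zero_mor_in[OF C ob2(1)]] by blast
  qed
  thus ?thesis
    by (rule cancel_left[OF C ob2(1,2) hom2(1) _ assms(4-6)])
qed

lemma unique_triangle_mors:
  assumes T1: "(C\<^sub>1, I, U\<^sub>1, \<epsilon>\<^sub>1, \<eta>\<^sub>1, \<delta>\<^sub>1) \<in> Dist \<A>" and T2: "(C\<^sub>2, I, U\<^sub>2, \<epsilon>\<^sub>2, \<eta>\<^sub>2, \<delta>\<^sub>2) \<in> Dist \<A>"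
    and orth: "\<And>f. f \<in> Hom \<A> (C\<^sub>1\<lbrakk>1\<rbrakk>\<^sub>o) U\<^sub>2 \<Longrightarrow> f = zero_mor \<A> (C\<^sub>1\<lbrakk>1\<rbrakk>\<^sub>o) U\<^sub>2"
    and ex: "\<exists>\<nu>\<in>Hom \<A> U\<^sub>1 U\<^sub>2. \<nu> \<cdot> \<eta>\<^sub>1 = \<eta>\<^sub>2"
  shows "\<exists>!\<nu>. \<nu> \<in> Hom \<A> U\<^sub>1 U\<^sub>2 \<and> \<nu> \<cdot> \<eta>\<^sub>1 = \<eta>\<^sub>2" (is ?unique_factor)
    and "\<exists>!\<theta>. \<theta> \<in> Hom \<A> C\<^sub>1 C\<^sub>2 \<and> \<epsilon>\<^sub>2 \<cdot> \<theta> = \<epsilon>\<^sub>1" (is ?unique_cofactor)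
    and "\<And>\<nu>. \<lbrakk>\<nu> \<in> Hom \<A> U\<^sub>1 U\<^sub>2; \<nu> \<cdot> \<eta>\<^sub>1 = \<eta>\<^sub>2\<rbrakk> \<Longrightarrow> \<exists>!\<theta>. triangle_mor \<A>
        (C\<^sub>1, I, U\<^sub>1, \<epsilon>\<^sub>1, \<eta>\<^sub>1, \<delta>\<^sub>1) (C\<^sub>2, I, U\<^sub>2, \<epsilon>\<^sub>2, \<eta>\<^sub>2, \<delta>\<^sub>2) \<theta> (ident \<A> I) \<nu>"
    and "\<And>\<theta>. \<lbrakk>\<theta> \<in> Hom \<A> C\<^sub>1 C\<^sub>2; \<epsilon>\<^sub>2 \<cdot> \<theta> = \<epsilon>\<^sub>1\<rbrakk> \<Longrightarrow> \<exists>!\<nu>. triangle_mor \<A>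
        (C\<^sub>1, I, U\<^sub>1, \<epsilon>\<^sub>1, \<eta>\<^sub>1, \<delta>\<^sub>1) (C\<^sub>2, I, U\<^sub>2, \<epsilon>\<^sub>2, \<eta>\<^sub>2, \<delta>\<^sub>2) \<theta> (ident \<A> I) \<nu>"
proof -
  note ob1 = Dist_Ob[OF T1] and hom1 = Dist_Hom[OF T1]
  note ob2 = Dist_Ob[OF T2] and hom2 = Dist_Hom[OF T2]
  let ?mor = "\<lambda>\<theta> \<nu>. triangle_mor \<A> (C\<^sub>1, I, U\<^sub>1, \<epsilon>\<^sub>1, \<eta>\<^sub>1, \<delta>\<^sub>1) (C\<^sub>2, I, U\<^sub>2, \<epsilon>\<^sub>2, \<eta>\<^sub>2, \<delta>\<^sub>2) \<theta> (ident \<A> I) \<nu>"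
  have ids: "ident \<A> I \<cdot> \<epsilon>\<^sub>1 = \<epsilon>\<^sub>1" "\<eta>\<^sub>2 \<cdot> ident \<A> I = \<eta>\<^sub>2"
    using ident_comp[OF ob1(1,2) hom1(1)] comp_ident[OF ob2(2,3) hom2(2)] by simp_all
  have mor: "\<theta> \<in> Hom \<A> C\<^sub>1 C\<^sub>2 \<and> \<epsilon>\<^sub>2 \<cdot> \<theta> = \<epsilon>\<^sub>1 \<and> \<nu> \<in> Hom \<A> U\<^sub>1 U\<^sub>2 \<and> \<nu> \<cdot> \<eta>\<^sub>1 = \<eta>\<^sub>2" if "?mor \<theta> \<nu>" for \<theta> \<nu>
    using that ids by simp
  have complete: "\<exists>\<nu>. ?mor \<theta> \<nu>" if "\<theta> \<in> Hom \<A> C\<^sub>1 C\<^sub>2" "\<epsilon>\<^sub>2 \<cdot> \<theta> = \<epsilon>\<^sub>1" for \<theta>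
    using Dist_complete[OF T1 T2 that(1) ident_in[OF ob1(2)]] that(2) ids(1) by simp
  note uniq = factor_unique[OF T1 T2 orth] and couniq = cofactor_unique[OF T1 T2 orth]
  show ?unique_factor
    using ex uniq by metis
  show cofactor: ?unique_cofactor
    using ex couniq factor_iff_cofactor[OF T1 T2] by metis
  show "\<exists>!\<nu>. ?mor \<theta> \<nu>" if "\<theta> \<in> Hom \<A> C\<^sub>1 C\<^sub>2" "\<epsilon>\<^sub>2 \<cdot> \<theta> = \<epsilon>\<^sub>1" for \<theta>
    using complete[OF that] mor uniq by metis
  show "\<exists>!\<theta>. ?mor \<theta> \<nu>" if "\<nu> \<in> Hom \<A> U\<^sub>1 U\<^sub>2" "\<nu> \<cdot> \<eta>\<^sub>1 = \<eta>\<^sub>2" for \<nu>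
  proof -
    \<comment> \<open>\<open>Dist_complete\<close> fills in third components only, so the morphism
      is built from \<open>\<theta>\<close>; its third component \<open>\<nu>'\<close> is then the
      given \<open>\<nu>\<close> by uniqueness.\<close>
    obtain \<theta> \<nu>' where "?mor \<theta> \<nu>'"
      using cofactor complete by blast
    moreover from this have "\<nu>' = \<nu>"
      using mor uniq that by metis
    ultimately show ?thesis
      using mor couniq by metis
  qed
qed

end

section \<open>Exact tensor products and orthogonality\<close>

text \<open>
  Only the exactness of the tensor product matters, not the form of its connecting maps; stated
  this way the axioms are invariant under reversing the tensor product.
\<close>

locale exact_tensor = triangulated_category \<A>
  for \<A> :: "('o, 'm, 'x) pretriangulated_category_scheme" (structure) +
  fixes tob :: "'o \<Rightarrow> 'o \<Rightarrow> 'o"  (infixl "\<odot>" 70)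
    and tmor :: "'m \<Rightarrow> 'm \<Rightarrow> 'm"  (infixl "\<odot>\<^sub>m" 70)
    and I :: 'o and l r :: "'o \<Rightarrow> 'm"
  assumes I_in: "I \<in> Ob \<A>"
    and tob_in: "\<lbrakk>A \<in> Ob \<A>; B \<in> Ob \<A>\<rbrakk> \<Longrightarrow> A \<odot> B \<in> Ob \<A>"
    and tmor_in: "\<lbrakk>A \<in> Ob \<A>; A' \<in> Ob \<A>; B \<in> Ob \<A>; B' \<in> Ob \<A>;
        f \<in> Hom \<A> A A'; g \<in> Hom \<A> B B'\<rbrakk> \<Longrightarrow> f \<odot>\<^sub>m g \<in> Hom \<A> (A \<odot> B) (A' \<odot> B')"
    and tmor_ident: "\<lbrakk>A \<in> Ob \<A>; B \<in> Ob \<A>\<rbrakk> \<Longrightarrow> ident \<A> A \<odot>\<^sub>m ident \<A> B = ident \<A> (A \<odot> B)"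
    and tmor_comp: "\<lbrakk>A \<in> Ob \<A>; A' \<in> Ob \<A>; A'' \<in> Ob \<A>; B \<in> Ob \<A>; B' \<in> Ob \<A>; B'' \<in> Ob \<A>;
        f \<in> Hom \<A> A A'; f' \<in> Hom \<A> A' A''; g \<in> Hom \<A> B B'; g' \<in> Hom \<A> B' B''\<rbrakk>
      \<Longrightarrow> (f' \<cdot> f) \<odot>\<^sub>m (g' \<cdot> g) = (f' \<odot>\<^sub>m g') \<cdot> (f \<odot>\<^sub>m g)"
    and tob_assoc: "\<lbrakk>A \<in> Ob \<A>; B \<in> Ob \<A>; C \<in> Ob \<A>\<rbrakk> \<Longrightarrow> (A \<odot> B) \<odot> C \<simeq> A \<odot> (B \<odot> C)"
    and l_iso: "A \<in> Ob \<A> \<Longrightarrow> iso_mor \<A> (I \<odot> A) A (l A)"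
    and l_natural: "\<lbrakk>A \<in> Ob \<A>; B \<in> Ob \<A>; f \<in> Hom \<A> A B\<rbrakk> \<Longrightarrow> l B \<cdot> (ident \<A> I \<odot>\<^sub>m f) = f \<cdot> l A"
    and r_iso: "A \<in> Ob \<A> \<Longrightarrow> iso_mor \<A> (A \<odot> I) A (r A)"
    and r_natural: "\<lbrakk>A \<in> Ob \<A>; B \<in> Ob \<A>; f \<in> Hom \<A> A B\<rbrakk> \<Longrightarrow> r B \<cdot> (f \<odot>\<^sub>m ident \<A> I) = f \<cdot> r A"
    and tens_exact_left: "\<lbrakk>D \<in> Ob \<A>; (A, B, C, f, g, h) \<in> Dist \<A>\<rbrakk> \<Longrightarrow>
      \<exists>k. (D \<odot> A, D \<odot> B, D \<odot> C, ident \<A> D \<odot>\<^sub>m f, ident \<A> D \<odot>\<^sub>m g, k) \<in> Dist \<A>"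
    and tens_exact_right: "\<lbrakk>D \<in> Ob \<A>; (A, B, C, f, g, h) \<in> Dist \<A>\<rbrakk> \<Longrightarrow>
      \<exists>k. (A \<odot> D, B \<odot> D, C \<odot> D, f \<odot>\<^sub>m ident \<A> D, g \<odot>\<^sub>m ident \<A> D, k) \<in> Dist \<A>"
begin

text \<open>Flipping exchanges the unitors and the two exactness axioms and inverts the
  associativity isomorphism. Everything proved for \<open>\<odot>\<close> thus also holds with the
  factors reversed.\<close>

lemma exact_tensor_flip: "exact_tensor \<A> (\<lambda>A B. B \<odot> A) (\<lambda>f g. g \<odot>\<^sub>m f) I r l"
proof unfold_locales
  show "C \<odot> (B \<odot> A) \<simeq> (C \<odot> B) \<odot> A" if "A \<in> Ob \<A>" "B \<in> Ob \<A>" "C \<in> Ob \<A>" for A B C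
    using that tob_assoc iso_obj_sym by blast
qed (rule I_in tob_in tmor_in tmor_ident tmor_comp l_iso l_natural r_iso r_natural
    tens_exact_left tens_exact_right; assumption)+

lemma unit_iso: "A \<in> Ob \<A> \<Longrightarrow> I \<odot> A \<simeq> A"
  using l_iso unfolding iso_obj_def by blast

text \<open>In the tensored triangle \<open>D \<odot> Z \<rightarrow> D \<odot> Z \<rightarrow> D \<odot> Z\<close> both maps are the identity, and their composite is zero.\<close>

lemma tens_zero_right:
  assumes Z: "zero_object \<A> Z" and D: "D \<in> Ob \<A>"
  shows "zero_object \<A> (D \<odot> Z)"
proof -
  have ob: "Z \<in> Ob \<A>" "D \<odot> Z \<in> Ob \<A>"
    using Z D zero_object_in tob_in by blast+
  obtain k where "(D \<odot> Z, D \<odot> Z, D \<odot> Z, ident \<A> D \<odot>\<^sub>m ident \<A> Z,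
      ident \<A> D \<odot>\<^sub>m zero_mor \<A> Z Z, k) \<in> Dist \<A>"
    using tens_exact_left[OF D Dist_ident[OF ob(1) Z]] by blast
  hence "ident \<A> (D \<odot> Z) \<cdot> ident \<A> (D \<odot> Z) = zero_mor \<A> (D \<odot> Z) (D \<odot> Z)"
    using Dist_comp_zero Z tmor_ident[OF D ob(1)] by (fastforce simp: zero_object_iff)
  thus ?thesis
    using ob ident_comp[OF ob(2,2) ident_in[OF ob(2)]] by (simp add: zero_object_iff)
qed

lemma tens_zero_left: "\<lbrakk>zero_object \<A> Z; D \<in> Ob \<A>\<rbrakk> \<Longrightarrow> zero_object \<A> (Z \<odot> D)"
  using exact_tensor.tens_zero_right[OF exact_tensor_flip] .

text \<open>Tensoring with \<open>D\<close> is functorial, so \<open>D \<odot> A\<close> is a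
  retract of \<open>D \<odot> B\<close>.\<close>

lemma tens_retract:
  assumes D: "D \<in> Ob \<A>" and ob: "A \<in> Ob \<A>" "B \<in> Ob \<A>" and zero: "zero_object \<A> (D \<odot> B)"
    and s: "s \<in> Hom \<A> A B" and p: "p \<in> Hom \<A> B A" and ps: "p \<cdot> s = ident \<A> A"
  shows "zero_object \<A> (D \<odot> A)"
proof (rule zero_object_retract[OF zero])
  show "D \<odot> A \<in> Ob \<A>"
    using D ob tob_in by blast
  show "ident \<A> D \<odot>\<^sub>m s \<in> Hom \<A> (D \<odot> A) (D \<odot> B)" "ident \<A> D \<odot>\<^sub>m p \<in> Hom \<A> (D \<odot> B) (D \<odot> A)"
    using D ob s p ident_in tmor_in by blast+
  show "(ident \<A> D \<odot>\<^sub>m p) \<cdot> (ident \<A> D \<odot>\<^sub>m s) = ident \<A> (D \<odot> A)"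
    using tmor_comp[OF D D D ob ob(1) ident_in[OF D] ident_in[OF D] s p] ps
      ident_comp[OF D D ident_in[OF D]] tmor_ident[OF D ob(1)] by simp
qed

text \<open>The rotated identity triangle runs from \<open>A\<close> over a zero object to the
  suspension of \<open>A\<close>. After tensoring with \<open>D\<close> its first two vertices are
  zero, hence so is the third; no comparison with the suspension of \<open>D \<odot> A\<close>
  enters.\<close>

lemma tens_shift_zero:
  assumes D: "D \<in> Ob \<A>" and A: "A \<in> Ob \<A>" and zero: "zero_object \<A> (D \<odot> A)"
  shows "zero_object \<A> (D \<odot> A\<lbrakk>1\<rbrakk>\<^sub>o)"
proof -
  obtain Z where Z: "zero_object \<A> Z"
    using ex_zero_object by blast
  show ?thesis
    using tens_exact_left[OF D Dist_rotate_forward[OF Dist_ident[OF A Z]]]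
      Dist_third_zero zero tens_zero_right[OF Z D] by blast
qed

text \<open>
  For \<open>f : X \<rightarrow> Y\<close>, the map \<open>(I \<odot> f) \<circ> (\<epsilon> \<odot> X)\<close> factors through \<open>C \<odot> Y\<close>, so \<open>I \<odot> f\<close> factors
  through \<open>U \<odot> X\<close>.
\<close>

lemma hom_orthogonal:
  assumes T: "(C, I, U, \<epsilon>, \<eta>, \<delta>) \<in> Dist \<A>"
    and X: "X \<in> Ob \<A>" "zero_object \<A> (U \<odot> X)" and Y: "Y \<in> Ob \<A>" "zero_object \<A> (C \<odot> Y)"
    and f: "f \<in> Hom \<A> X Y"
  shows "f = zero_mor \<A> X Y"
proof -
  note ob = Dist_Ob[OF T] and hom = Dist_Hom[OF T]
  note idI = ident_in[OF ob(2)] and idC = ident_in[OF ob(1)]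
  have obs: "C \<odot> X \<in> Ob \<A>" "I \<odot> X \<in> Ob \<A>" "U \<odot> X \<in> Ob \<A>" "C \<odot> Y \<in> Ob \<A>" "I \<odot> Y \<in> Ob \<A>"
    using ob X Y tob_in by blast+
  have homs: "\<epsilon> \<odot>\<^sub>m ident \<A> Y \<in> Hom \<A> (C \<odot> Y) (I \<odot> Y)" "ident \<A> C \<odot>\<^sub>m f \<in> Hom \<A> (C \<odot> X) (C \<odot> Y)"
      "ident \<A> I \<odot>\<^sub>m f \<in> Hom \<A> (I \<odot> X) (I \<odot> Y)" "\<eta> \<odot>\<^sub>m ident \<A> X \<in> Hom \<A> (I \<odot> X) (U \<odot> X)"
    using ob hom X Y f ident_in tmor_in by blast+
  have "(ident \<A> I \<odot>\<^sub>m f) \<cdot> (\<epsilon> \<odot>\<^sub>m ident \<A> X) = (\<epsilon> \<odot>\<^sub>m ident \<A> Y) \<cdot> (ident \<A> C \<odot>\<^sub>m f)"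
    using tmor_comp[OF ob(1,2,2) X(1,1) Y(1) hom(1) idI ident_in[OF X(1)] f]
      tmor_comp[OF ob(1,1,2) X(1) Y(1,1) idC hom(1) f ident_in[OF Y(1)]]
      ident_comp[OF ob(1,2) hom(1)] comp_ident[OF ob(1,2) hom(1)]
      ident_comp[OF X(1) Y(1) f] comp_ident[OF X(1) Y(1) f] by simp
  also have "\<dots> = zero_mor \<A> (C \<odot> X) (I \<odot> Y)"
    using to_zero_object[OF Y(2) obs(1) homs(2)] comp_zero[OF obs(1,4,5) homs(1)] by simp
  finally obtain v where v: "v \<in> Hom \<A> (U \<odot> X) (I \<odot> Y)" "v \<cdot> (\<eta> \<odot>\<^sub>m ident \<A> X) = ident \<A> I \<odot>\<^sub>m f"
    using tens_exact_right[OF X(1) T] extend_along_snd[OF _ obs(5) homs(3)] by blast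
  have If: "ident \<A> I \<odot>\<^sub>m f = zero_mor \<A> (I \<odot> X) (I \<odot> Y)"
    using v from_zero_object[OF X(2) obs(5) v(1)] zero_comp[OF obs(2,3,5) homs(4)] by simp
  \<comment> \<open>Naturality of \<open>l\<close> turns the vanishing of
    \<open>ident \<A> I \<odot>\<^sub>m f\<close> into that of \<open>f \<cdot> l X\<close>, and
    \<open>l X\<close> has the right inverse \<open>k\<close>.\<close>
  obtain k where k: "l X \<in> Hom \<A> (I \<odot> X) X" "k \<in> Hom \<A> X (I \<odot> X)" "l X \<cdot> k = ident \<A> X"
    using iso_morD[OF l_iso[OF X(1)]] by blast
  have "l Y \<in> Hom \<A> (I \<odot> Y) Y"
    using iso_morD[OF l_iso[OF Y(1)]] by blast
  hence "f \<cdot> l X = zero_mor \<A> (I \<odot> X) Y"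
    using If l_natural[OF X(1) Y(1) f] comp_zero[OF obs(2,5) Y(1)] by simp
  thus ?thesis
    using k comp_assoc[OF X(1) obs(2) X(1) Y(1) k(2,1) f] comp_ident[OF X(1) Y(1) f]
      zero_comp[OF X(1) obs(2) Y(1) k(2)] by simp
qed

section \<open>Absorption, annihilation and factorization\<close>

text \<open>In the triangle \<open>C \<odot> X -> I \<odot> X -> U \<odot> X\<close>, a zero first
  vertex makes the other two isomorphic. Conversely, any isomorphism, whether or not it comes from
  \<open>\<eta>\<close>, makes \<open>X\<close> a retract of \<open>U \<odot> X\<close>, which
  \<open>C\<close> annihilates.\<close>

lemma unital_absorb_iff:
  assumes T: "(C, I, U, \<epsilon>, \<eta>, \<delta>) \<in> Dist \<A>" and CU: "zero_object \<A> (C \<odot> U)" and X: "X \<in> Ob \<A>"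
  shows "zero_object \<A> (C \<odot> X) \<longleftrightarrow> U \<odot> X \<simeq> X"
proof
  note ob = Dist_Ob[OF T]
  note obs = tob_in[OF ob(1) X] tob_in[OF ob(2) X] tob_in[OF ob(3) X]
  {
    assume "zero_object \<A> (C \<odot> X)"
    hence "I \<odot> X \<simeq> U \<odot> X"
      using tens_exact_right[OF X T] Dist_snd_iso by blast
    thus "U \<odot> X \<simeq> X"
      using iso_obj_sym iso_obj_trans[OF obs(3,2) X] unit_iso[OF X] by blast
  next
    assume UX: "U \<odot> X \<simeq> X"
    have "zero_object \<A> (C \<odot> (U \<odot> X))"
      using zero_object_iso[OF tens_zero_left[OF CU X]] tob_in[OF ob(1) obs(3)]
        iso_obj_sym[OF tob_assoc[OF ob(1,3) X]] by blast
    moreover obtain p s where "p \<in> Hom \<A> (U \<odot> X) X" "s \<in> Hom \<A> X (U \<odot> X)" "p \<cdot> s = ident \<A> X"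
      using UX by (rule iso_objE)
    ultimately show "zero_object \<A> (C \<odot> X)"
      using tens_retract[OF ob(1) X obs(3)] by blast
  }
qed

text \<open>The same triangle read from the other end: a zero third vertex makes the first two
  isomorphic, and conversely \<open>U\<close> annihilates \<open>C \<odot> X\<close>.\<close>

lemma counital_absorb_iff:
  assumes T: "(C, I, U, \<epsilon>, \<eta>, \<delta>) \<in> Dist \<A>" and UC: "zero_object \<A> (U \<odot> C)" and X: "X \<in> Ob \<A>"
  shows "zero_object \<A> (U \<odot> X) \<longleftrightarrow> C \<odot> X \<simeq> X"
proof
  note ob = Dist_Ob[OF T]
  note obs = tob_in[OF ob(1) X] tob_in[OF ob(2) X] tob_in[OF ob(3) X]
  {
    assume "zero_object \<A> (U \<odot> X)"
    hence "C \<odot> X \<simeq> I \<odot> X"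
      using tens_exact_right[OF X T] Dist_fst_iso by blast
    thus "C \<odot> X \<simeq> X"
      using iso_obj_trans[OF obs(1,2) X] unit_iso[OF X] by blast
  next
    assume CX: "C \<odot> X \<simeq> X"
    have "zero_object \<A> (U \<odot> (C \<odot> X))"
      using zero_object_iso[OF tens_zero_left[OF UC X]] tob_in[OF ob(3) obs(1)]
        iso_obj_sym[OF tob_assoc[OF ob(3,1) X]] by blast
    moreover obtain p s where "p \<in> Hom \<A> (C \<odot> X) X" "s \<in> Hom \<A> X (C \<odot> X)" "p \<cdot> s = ident \<A> X"
      using CX by (rule iso_objE)
    ultimately show "zero_object \<A> (U \<odot> X)"
      using tens_retract[OF ob(3) X obs(1)] by blast
  }
qed

text \<open>
  Since \<open>\<eta>\<^sub>2 \<odot> U\<^sub>2 = (\<nu> \<odot> U\<^sub>2) \<circ> (\<eta>\<^sub>1 \<odot> U\<^sub>2)\<close> is split mono, \<open>U\<^sub>2\<close> is a retract of \<open>U\<^sub>1 \<odot> U\<^sub>2\<close>,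
  which \<open>C\<^sub>1\<close> annihilates.
\<close>

lemma zero_tens_if_factor:
  assumes T1: "(C\<^sub>1, I, U\<^sub>1, \<epsilon>\<^sub>1, \<eta>\<^sub>1, \<delta>\<^sub>1) \<in> Dist \<A>" and CU1: "zero_object \<A> (C\<^sub>1 \<odot> U\<^sub>1)"
    and T2: "(C\<^sub>2, I, U\<^sub>2, \<epsilon>\<^sub>2, \<eta>\<^sub>2, \<delta>\<^sub>2) \<in> Dist \<A>" and CU2: "zero_object \<A> (C\<^sub>2 \<odot> U\<^sub>2)"
    and \<nu>: "\<nu> \<in> Hom \<A> U\<^sub>1 U\<^sub>2" "\<nu> \<cdot> \<eta>\<^sub>1 = \<eta>\<^sub>2"
  shows "zero_object \<A> (C\<^sub>1 \<odot> U\<^sub>2)"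
proof -
  note ob1 = Dist_Ob[OF T1] and hom1 = Dist_Hom[OF T1]
  note ob2 = Dist_Ob[OF T2] and hom2 = Dist_Hom[OF T2]
  note U = ob2(3) and idU = ident_in[OF ob2(3)]
  have obs: "I \<odot> U\<^sub>2 \<in> Ob \<A>" "U\<^sub>1 \<odot> U\<^sub>2 \<in> Ob \<A>" "U\<^sub>2 \<odot> U\<^sub>2 \<in> Ob \<A>" "C\<^sub>2 \<odot> U\<^sub>2 \<in> Ob \<A>"
    using ob1 ob2 tob_in by blast+
  have homs: "\<eta>\<^sub>1 \<odot>\<^sub>m ident \<A> U\<^sub>2 \<in> Hom \<A> (I \<odot> U\<^sub>2) (U\<^sub>1 \<odot> U\<^sub>2)"
      "\<nu> \<odot>\<^sub>m ident \<A> U\<^sub>2 \<in> Hom \<A> (U\<^sub>1 \<odot> U\<^sub>2) (U\<^sub>2 \<odot> U\<^sub>2)"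
      "\<epsilon>\<^sub>2 \<odot>\<^sub>m ident \<A> U\<^sub>2 \<in> Hom \<A> (C\<^sub>2 \<odot> U\<^sub>2) (I \<odot> U\<^sub>2)"
    using ob1 ob2 hom1 hom2 \<nu>(1) idU tmor_in by blast+
  \<comment> \<open>Since \<open>\<epsilon>\<^sub>2 \<odot>\<^sub>m ident \<A> U\<^sub>2\<close>
    starts at a zero object, the identity extends along the next map of the tensored triangle; the
    extension is the retraction \<open>q\<close>.\<close>
  have "ident \<A> (I \<odot> U\<^sub>2) \<cdot> (\<epsilon>\<^sub>2 \<odot>\<^sub>m ident \<A> U\<^sub>2) = zero_mor \<A> (C\<^sub>2 \<odot> U\<^sub>2) (I \<odot> U\<^sub>2)"
    using from_zero_object[OF CU2 obs(1) homs(3)] ident_comp[OF obs(4,1) homs(3)] by simp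
  then obtain q where q: "q \<in> Hom \<A> (U\<^sub>2 \<odot> U\<^sub>2) (I \<odot> U\<^sub>2)"
      "q \<cdot> (\<eta>\<^sub>2 \<odot>\<^sub>m ident \<A> U\<^sub>2) = ident \<A> (I \<odot> U\<^sub>2)"
    using tens_exact_right[OF U T2] extend_along_snd[OF _ obs(1) ident_in[OF obs(1)]] by blast
  have "\<eta>\<^sub>2 \<odot>\<^sub>m ident \<A> U\<^sub>2 = (\<nu> \<odot>\<^sub>m ident \<A> U\<^sub>2) \<cdot> (\<eta>\<^sub>1 \<odot>\<^sub>m ident \<A> U\<^sub>2)"
    using tmor_comp[OF ob1(2,3) U U U U hom1(2) \<nu>(1) idU idU] \<nu>(2) ident_comp[OF U U idU] by simp
  hence split: "(q \<cdot> (\<nu> \<odot>\<^sub>m ident \<A> U\<^sub>2)) \<cdot> (\<eta>\<^sub>1 \<odot>\<^sub>m ident \<A> U\<^sub>2) = ident \<A> (I \<odot> U\<^sub>2)"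
    using comp_assoc[OF obs(1,2,3,1) homs(1,2) q(1)] q(2) by simp
  note qn = comp_in[OF obs(2,3,1) homs(2) q(1)]
  obtain i where i: "l U\<^sub>2 \<in> Hom \<A> (I \<odot> U\<^sub>2) U\<^sub>2" "i \<in> Hom \<A> U\<^sub>2 (I \<odot> U\<^sub>2)" "l U\<^sub>2 \<cdot> i = ident \<A> U\<^sub>2"
    using iso_morD[OF l_iso[OF U]] by blast
  have "zero_object \<A> (C\<^sub>1 \<odot> (U\<^sub>1 \<odot> U\<^sub>2))"
    using zero_object_iso[OF tens_zero_left[OF CU1 U]] tob_in[OF ob1(1) obs(2)]
      iso_obj_sym[OF tob_assoc[OF ob1(1,3) U]] by blast
  thus ?thesis
    using tens_retract[OF ob1(1) U obs(2)] comp_in[OF U obs(1,2) i(2) homs(1)]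
      comp_in[OF obs(2,1) U qn i(1)] retract_trans[OF U obs(1,2) i(2,1,3) homs(1) qn split] by blast
qed

text \<open>\<open>\<eta>\<^sub>2 \<cdot> \<epsilon>\<^sub>1\<close> goes from an object annihilated
  by \<open>U\<^sub>1\<close> to one annihilated by \<open>C\<^sub>1\<close>, so it vanishes by
  orthogonality.\<close>

lemma factor_exists:
  assumes T1: "(C\<^sub>1, I, U\<^sub>1, \<epsilon>\<^sub>1, \<eta>\<^sub>1, \<delta>\<^sub>1) \<in> Dist \<A>" and UC1: "zero_object \<A> (U\<^sub>1 \<odot> C\<^sub>1)"
    and T2: "(C\<^sub>2, I, U\<^sub>2, \<epsilon>\<^sub>2, \<eta>\<^sub>2, \<delta>\<^sub>2) \<in> Dist \<A>" and CU: "zero_object \<A> (C\<^sub>1 \<odot> U\<^sub>2)"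
  shows "\<exists>\<nu>\<in>Hom \<A> U\<^sub>1 U\<^sub>2. \<nu> \<cdot> \<eta>\<^sub>1 = \<eta>\<^sub>2"
proof -
  note ob1 = Dist_Ob[OF T1] and hom1 = Dist_Hom[OF T1]
  note ob2 = Dist_Ob[OF T2] and hom2 = Dist_Hom[OF T2]
  have "\<eta>\<^sub>2 \<cdot> \<epsilon>\<^sub>1 = zero_mor \<A> C\<^sub>1 U\<^sub>2"
    using hom_orthogonal[OF T1 ob1(1) UC1 ob2(3) CU] comp_in[OF ob1(1,2) ob2(3) hom1(1) hom2(2)] by blast
  thus ?thesis
    using extend_along_snd[OF T1 ob2(3) hom2(2)] by blast
qed

text \<open>The pivot: each absorption condition reduces to the left-hand side, for
  \<open>\<odot>\<close> or for its flip, while the right-hand side is independent of the tensor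
  product.\<close>

lemma factor_iff:
  assumes T1: "(C\<^sub>1, I, U\<^sub>1, \<epsilon>\<^sub>1, \<eta>\<^sub>1, \<delta>\<^sub>1) \<in> Dist \<A>"
    and CU1: "zero_object \<A> (C\<^sub>1 \<odot> U\<^sub>1)" and UC1: "zero_object \<A> (U\<^sub>1 \<odot> C\<^sub>1)"
    and T2: "(C\<^sub>2, I, U\<^sub>2, \<epsilon>\<^sub>2, \<eta>\<^sub>2, \<delta>\<^sub>2) \<in> Dist \<A>" and CU2: "zero_object \<A> (C\<^sub>2 \<odot> U\<^sub>2)"
  shows "zero_object \<A> (C\<^sub>1 \<odot> U\<^sub>2) \<longleftrightarrow> (\<exists>\<nu>\<in>Hom \<A> U\<^sub>1 U\<^sub>2. \<nu> \<cdot> \<eta>\<^sub>1 = \<eta>\<^sub>2)"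
  using factor_exists[OF T1 UC1 T2] zero_tens_if_factor[OF T1 CU1 T2 CU2] by blast

text \<open>\<open>U\<^sub>1\<close> annihilates the suspension of \<open>C\<^sub>1\<close> as well,
  so orthogonality applies. Such maps are the obstructions in \<open>factor_unique\<close> and
  \<open>cofactor_unique\<close>.\<close>

lemma hom_shift_orthogonal:
  assumes T1: "(C\<^sub>1, I, U\<^sub>1, \<epsilon>\<^sub>1, \<eta>\<^sub>1, \<delta>\<^sub>1) \<in> Dist \<A>" and UC1: "zero_object \<A> (U\<^sub>1 \<odot> C\<^sub>1)"
    and Y: "Y \<in> Ob \<A>" "zero_object \<A> (C\<^sub>1 \<odot> Y)" and f: "f \<in> Hom \<A> (C\<^sub>1\<lbrakk>1\<rbrakk>\<^sub>o) Y"
  shows "f = zero_mor \<A> (C\<^sub>1\<lbrakk>1\<rbrakk>\<^sub>o) Y"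
  using hom_orthogonal[OF T1 shift_obj_in tens_shift_zero Y f] Dist_Ob[OF T1] UC1 by blast

end

section \<open>The equivalences in a triangulated monoidal category\<close>

lemma (in triangulated_monoidal_category) exact_tensor:
  "exact_tensor \<A> (tens_obj \<A>) (tens_mor \<A>) \<one>\<^sub>o (lun \<A>) (run \<A>)"
proof unfold_locales
  show "(A \<otimes>\<^sub>o B) \<otimes>\<^sub>o C \<simeq> A \<otimes>\<^sub>o (B \<otimes>\<^sub>o C)" if "A \<in> Ob \<A>" "B \<in> Ob \<A>" "C \<in> Ob \<A>" for A B C
    using assoc_iso[OF that] unfolding iso_obj_def by blast
qed ((rule unit_in tens_obj_in tens_mor_in tens_ident tens_comp lun_iso lun_natural
    run_iso run_natural; assumption) | (rule exI, rule Dist_tens_left Dist_tens_right; assumption))+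

theorem theorem1p7:
  fixes \<A> :: "('o, 'm, 'x) tensor_triangulated_scheme"
    and C\<^sub>1 U\<^sub>1 C\<^sub>2 U\<^sub>2 :: 'o
    and \<epsilon>\<^sub>1 \<eta>\<^sub>1 \<delta>\<^sub>1 \<epsilon>\<^sub>2 \<eta>\<^sub>2 \<delta>\<^sub>2 :: 'm
  assumes "triangulated_monoidal_category \<A>"
    and "complementary_idempotents \<A> C\<^sub>1 U\<^sub>1 \<epsilon>\<^sub>1 \<eta>\<^sub>1 \<delta>\<^sub>1"
    and "complementary_idempotents \<A> C\<^sub>2 U\<^sub>2 \<epsilon>\<^sub>2 \<eta>\<^sub>2 \<delta>\<^sub>2"
  shows "((U\<^sub>1 \<otimes>\<^sub>o\<^bsub>\<A>\<^esub> U\<^sub>2 \<simeq>\<^bsub>\<A>\<^esub> U\<^sub>2) \<longleftrightarrow> (U\<^sub>2 \<otimes>\<^sub>o\<^bsub>\<A>\<^esub> U\<^sub>1 \<simeq>\<^bsub>\<A>\<^esub> U\<^sub>2)) \<and>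
    ((U\<^sub>2 \<otimes>\<^sub>o\<^bsub>\<A>\<^esub> U\<^sub>1 \<simeq>\<^bsub>\<A>\<^esub> U\<^sub>2) \<longleftrightarrow> (\<exists>\<nu>\<in>Hom \<A> U\<^sub>1 U\<^sub>2. \<nu> \<cdot>\<^bsub>\<A>\<^esub> \<eta>\<^sub>1 = \<eta>\<^sub>2)) \<and>
    ((U\<^sub>1 \<otimes>\<^sub>o\<^bsub>\<A>\<^esub> U\<^sub>2 \<simeq>\<^bsub>\<A>\<^esub> U\<^sub>2) \<or> (U\<^sub>2 \<otimes>\<^sub>o\<^bsub>\<A>\<^esub> U\<^sub>1 \<simeq>\<^bsub>\<A>\<^esub> U\<^sub>2) \<or>
       (\<exists>\<nu>\<in>Hom \<A> U\<^sub>1 U\<^sub>2. \<nu> \<cdot>\<^bsub>\<A>\<^esub> \<eta>\<^sub>1 = \<eta>\<^sub>2) \<longrightarrow>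
     (\<exists>!\<nu>. \<nu> \<in> Hom \<A> U\<^sub>1 U\<^sub>2 \<and> \<nu> \<cdot>\<^bsub>\<A>\<^esub> \<eta>\<^sub>1 = \<eta>\<^sub>2) \<and>
     (\<forall>\<nu>\<in>Hom \<A> U\<^sub>1 U\<^sub>2. \<nu> \<cdot>\<^bsub>\<A>\<^esub> \<eta>\<^sub>1 = \<eta>\<^sub>2 \<longrightarrow>
        (\<exists>!\<theta>. triangle_mor \<A> (C\<^sub>1, \<one>\<^sub>o\<^bsub>\<A>\<^esub>, U\<^sub>1, \<epsilon>\<^sub>1, \<eta>\<^sub>1, \<delta>\<^sub>1)
           (C\<^sub>2, \<one>\<^sub>o\<^bsub>\<A>\<^esub>, U\<^sub>2, \<epsilon>\<^sub>2, \<eta>\<^sub>2, \<delta>\<^sub>2)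
           \<theta> (ident \<A> \<one>\<^sub>o\<^bsub>\<A>\<^esub>) \<nu>))) \<and>
    ((C\<^sub>1 \<otimes>\<^sub>o\<^bsub>\<A>\<^esub> C\<^sub>2 \<simeq>\<^bsub>\<A>\<^esub> C\<^sub>1) \<longleftrightarrow> (C\<^sub>2 \<otimes>\<^sub>o\<^bsub>\<A>\<^esub> C\<^sub>1 \<simeq>\<^bsub>\<A>\<^esub> C\<^sub>1)) \<and>
    ((C\<^sub>2 \<otimes>\<^sub>o\<^bsub>\<A>\<^esub> C\<^sub>1 \<simeq>\<^bsub>\<A>\<^esub> C\<^sub>1) \<longleftrightarrow> (\<exists>\<theta>\<in>Hom \<A> C\<^sub>1 C\<^sub>2. \<epsilon>\<^sub>2 \<cdot>\<^bsub>\<A>\<^esub> \<theta> = \<epsilon>\<^sub>1)) \<and>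
    ((C\<^sub>1 \<otimes>\<^sub>o\<^bsub>\<A>\<^esub> C\<^sub>2 \<simeq>\<^bsub>\<A>\<^esub> C\<^sub>1) \<or> (C\<^sub>2 \<otimes>\<^sub>o\<^bsub>\<A>\<^esub> C\<^sub>1 \<simeq>\<^bsub>\<A>\<^esub> C\<^sub>1) \<or>
       (\<exists>\<theta>\<in>Hom \<A> C\<^sub>1 C\<^sub>2. \<epsilon>\<^sub>2 \<cdot>\<^bsub>\<A>\<^esub> \<theta> = \<epsilon>\<^sub>1) \<longrightarrow>
     (\<exists>!\<theta>. \<theta> \<in> Hom \<A> C\<^sub>1 C\<^sub>2 \<and> \<epsilon>\<^sub>2 \<cdot>\<^bsub>\<A>\<^esub> \<theta> = \<epsilon>\<^sub>1) \<and>
     (\<forall>\<theta>\<in>Hom \<A> C\<^sub>1 C\<^sub>2. \<epsilon>\<^sub>2 \<cdot>\<^bsub>\<A>\<^esub> \<theta> = \<epsilon>\<^sub>1 \<longrightarrow>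
        (\<exists>!\<nu>. triangle_mor \<A> (C\<^sub>1, \<one>\<^sub>o\<^bsub>\<A>\<^esub>, U\<^sub>1, \<epsilon>\<^sub>1, \<eta>\<^sub>1, \<delta>\<^sub>1)
           (C\<^sub>2, \<one>\<^sub>o\<^bsub>\<A>\<^esub>, U\<^sub>2, \<epsilon>\<^sub>2, \<eta>\<^sub>2, \<delta>\<^sub>2)
           \<theta> (ident \<A> \<one>\<^sub>o\<^bsub>\<A>\<^esub>) \<nu>)))"
proof -
  interpret triangulated_monoidal_category \<A> by fact
  interpret L: exact_tensor \<A> "tens_obj \<A>" "tens_mor \<A>" "\<one>\<^sub>o\<^bsub>\<A>\<^esub>" "lun \<A>" "run \<A>"
    by (rule exact_tensor)
  interpret R: exact_tensor \<A> "\<lambda>A B. tens_obj \<A> B A" "\<lambda>f g. tens_mor \<A> g f" "\<one>\<^sub>o\<^bsub>\<A>\<^esub>" "run \<A>" "lun \<A>"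
    by (rule L.exact_tensor_flip)
  have T1: "(C\<^sub>1, \<one>\<^sub>o\<^bsub>\<A>\<^esub>, U\<^sub>1, \<epsilon>\<^sub>1, \<eta>\<^sub>1, \<delta>\<^sub>1) \<in> Dist \<A>" and T2: "(C\<^sub>2, \<one>\<^sub>o\<^bsub>\<A>\<^esub>, U\<^sub>2, \<epsilon>\<^sub>2, \<eta>\<^sub>2, \<delta>\<^sub>2) \<in> Dist \<A>"
    using assms(2,3) by (simp_all add: complementary_idempotents_def)
  note ob1 = Dist_Ob[OF T1] and ob2 = Dist_Ob[OF T2]
  have CU1: "zero_object \<A> (C\<^sub>1 \<otimes>\<^sub>o\<^bsub>\<A>\<^esub> U\<^sub>1)" and UC1: "zero_object \<A> (U\<^sub>1 \<otimes>\<^sub>o\<^bsub>\<A>\<^esub> C\<^sub>1)"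
    and CU2: "zero_object \<A> (C\<^sub>2 \<otimes>\<^sub>o\<^bsub>\<A>\<^esub> U\<^sub>2)" and UC2: "zero_object \<A> (U\<^sub>2 \<otimes>\<^sub>o\<^bsub>\<A>\<^esub> C\<^sub>2)"
    using assms(2,3) iso_zero_imp_zero_object tens_obj_in
    unfolding complementary_idempotents_def by blast+
  let ?nu = "\<exists>\<nu>\<in>Hom \<A> U\<^sub>1 U\<^sub>2. \<nu> \<cdot>\<^bsub>\<A>\<^esub> \<eta>\<^sub>1 = \<eta>\<^sub>2"
  have a: "zero_object \<A> (C\<^sub>1 \<otimes>\<^sub>o\<^bsub>\<A>\<^esub> U\<^sub>2) \<longleftrightarrow> ?nu"
    by (rule L.factor_iff[OF T1 CU1 UC1 T2 CU2])
  \<comment> \<open>In \<open>R\<close> the two vanishing hypotheses trade places. As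
    \<open>?nu\<close> does not mention the tensor product, it links \<open>a\<close> and
    \<open>b\<close> although no symmetry of the tensor product is available.\<close>
  have b: "zero_object \<A> (U\<^sub>2 \<otimes>\<^sub>o\<^bsub>\<A>\<^esub> C\<^sub>1) \<longleftrightarrow> ?nu"
    by (rule R.factor_iff[OF T1 UC1 CU1 T2 UC2])
  have 1: "(U\<^sub>1 \<otimes>\<^sub>o\<^bsub>\<A>\<^esub> U\<^sub>2 \<simeq>\<^bsub>\<A>\<^esub> U\<^sub>2) \<longleftrightarrow> ?nu"
    using L.unital_absorb_iff[OF T1 CU1 ob2(3)] a by simp
  have 2: "(U\<^sub>2 \<otimes>\<^sub>o\<^bsub>\<A>\<^esub> U\<^sub>1 \<simeq>\<^bsub>\<A>\<^esub> U\<^sub>2) \<longleftrightarrow> ?nu"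
    using R.unital_absorb_iff[OF T1 UC1 ob2(3)] b by simp
  \<comment> \<open>Now the second pair absorbs and \<open>X\<close> is \<open>C\<^sub>1\<close>.
    The absorbing factor \<open>C\<^sub>2\<close> stands on the right, hence \<open>R\<close>, where
    the object to vanish is again the \<open>C\<^sub>1 \<otimes>\<^sub>o U\<^sub>2\<close> of
    \<open>a\<close>.\<close>
  have 3: "(C\<^sub>1 \<otimes>\<^sub>o\<^bsub>\<A>\<^esub> C\<^sub>2 \<simeq>\<^bsub>\<A>\<^esub> C\<^sub>1) \<longleftrightarrow> ?nu"
    using R.counital_absorb_iff[OF T2 CU2 ob1(1)] a by simp
  have 4: "(C\<^sub>2 \<otimes>\<^sub>o\<^bsub>\<A>\<^esub> C\<^sub>1 \<simeq>\<^bsub>\<A>\<^esub> C\<^sub>1) \<longleftrightarrow> ?nu"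
    using L.counital_absorb_iff[OF T2 UC2 ob1(1)] b by simp
  have 5: "(\<exists>\<theta>\<in>Hom \<A> C\<^sub>1 C\<^sub>2. \<epsilon>\<^sub>2 \<cdot>\<^bsub>\<A>\<^esub> \<theta> = \<epsilon>\<^sub>1) \<longleftrightarrow> ?nu"
    using factor_iff_cofactor[OF T1 T2] by simp
  have orth: "f = zero_mor \<A> (C\<^sub>1\<lbrakk>1\<rbrakk>\<^sub>o\<^bsub>\<A>\<^esub>) U\<^sub>2" if ?nu "f \<in> Hom \<A> (C\<^sub>1\<lbrakk>1\<rbrakk>\<^sub>o\<^bsub>\<A>\<^esub>) U\<^sub>2" for f
    using L.hom_shift_orthogonal[OF T1 UC1 ob2(3) _ that(2)] a that(1) by blast
  note unique = unique_triangle_mors[OF T1 T2 orth]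
  show ?thesis
    \<comment> \<open>After unfolding, every equivalent condition reads \<open>?nu\<close>, which is
      also what \<open>orth\<close> and the existence premise of \<open>unique\<close> ask
      for.\<close>
    unfolding 1 2 3 4 5 by (intro conjI refl impI ballI unique; (elim disjE)?; assumption)
qed

end
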